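(* Let $Q:\mathbb{T}^n\to[0,+\infty)$ be real analytic, let $\Phi_0\in\mathbb{T}^n$, and let $\Phi\in\mathscr{A}$ be a minimizer over $\mathscr{A}$ of $$K(\Phi)=\int_0^\infty\tfrac12\|\dot\Phi\|^2+Q(\Phi)\,dt .$$ Then: (1) $\Phi\in C^\infty([0,+\infty);\mathbb{T}^n)$; (2) the Euler-Lagrange equations are satisfied: $$\begin{cases}\ddot\Phi=\nabla Q(\Phi) & t\in(0,+\infty)\\ \Phi(0)=\Phi_0;\end{cases}$$ (3) the energy is conserved, namely $$E(t):=\tfrac12\|\dot\Phi(t)\|^2-Q(\Phi(t))\equiv0 .$$
   Context: $\mathbb{T}=\mathbb{R}/2\pi\mathbb{Z}$. $H^1_{loc}([0,+\infty);\mathbb{T}^n)$ is the set of maps $\Phi:[0,+\infty)\to\mathbb{T}^n$ belonging to $H^1((0,T);\mathbb{T}^n)$ for every $T>0$ (continuous, weakly differentiable with $\dot\Phi\in L^2((0,T);\mathbb{R}^n)$). The set of admissible trajectories is $$\mathscr{A}=\left\{\Phi\in H^1_{loc}([0,+\infty);\mathbb{T}^n)\ :\ \Phi(0)=\Phi_0,\ \tfrac12\|\dot\Phi\|^2+Q(\Phi)\in L^1(0,+\infty)\right\}.$$ *)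

theory Defs
  imports "HOL-Analysis.Analysis"
begin

quotient_type circle = real / "\<lambda>x y. \<exists>k::int. x - y = 2 * pi * of_int k"
proof (rule equivpI)
  show "reflp (\<lambda>x y. \<exists>k::int. x - y = 2 * pi * of_int k)"
    by (rule reflpI, rule exI[of _ 0]) simp
  show "symp (\<lambda>x y. \<exists>k::int. x - y = 2 * pi * of_int k)"
  proof (rule sympI)
    fix x y :: real
    assume "\<exists>k::int. x - y = 2 * pi * of_int k"
    then obtain k :: int where "x - y = 2 * pi * of_int k" ..
    then have "y - x = 2 * pi * of_int (- k)" by simp
    then show "\<exists>k::int. y - x = 2 * pi * of_int k" ..
  qed
  show "transp (\<lambda>x y. \<exists>k::int. x - y = 2 * pi * of_int k)"
  proof (rule transpI)
    fix x y z :: real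
    assume "\<exists>k::int. x - y = 2 * pi * of_int k" "\<exists>k::int. y - z = 2 * pi * of_int k"
    then obtain k l :: int where "x - y = 2 * pi * of_int k" "y - z = 2 * pi * of_int l"
      by blast
    then have "x - z = 2 * pi * of_int (k + l)" by (simp add: algebra_simps)
    then show "\<exists>k::int. x - z = 2 * pi * of_int k" ..
  qed
qed

type_synonym 'n torus = "circle ^ 'n"

definition torus_proj :: "real ^ 'n \<Rightarrow> 'n::finite torus" where
  "torus_proj x = (\<chi> i. abs_circle (x $ i))"

lemma torus_proj_eq_iff:
  "torus_proj x = torus_proj y \<longleftrightarrow> (\<forall>i. \<exists>k::int. x $ i - y $ i = 2 * pi * of_int k)"
  by (simp add: torus_proj_def vec_eq_iff circle.abs_eq_iff)

text \<open>Real analyticity: near every point the function is the sum of a convergent power series.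
  Multi-indices are the functions \<open>'n \<Rightarrow> nat\<close>; the sum over them is unordered, that is,
  absolutely convergent.\<close>

definition real_analytic :: "(real ^ 'n::finite \<Rightarrow> real) \<Rightarrow> bool" where
  "real_analytic f \<longleftrightarrow>
     (\<forall>x0. \<exists>r>0. \<exists>c :: ('n \<Rightarrow> nat) \<Rightarrow> real. \<forall>x \<in> ball x0 r.
        ((\<lambda>\<alpha>. c \<alpha> * (\<Prod>i\<in>UNIV. (x $ i - x0 $ i) ^ \<alpha> i)) has_sum f x) UNIV)"

definition torus_analytic :: "('n::finite torus \<Rightarrow> real) \<Rightarrow> bool" where
  "torus_analytic Q \<longleftrightarrow> real_analytic (\<lambda>x. Q (torus_proj x))"

text \<open>The projection is a local isometry, so the gradient of \<open>Q\<close> at \<open>p\<close> is the gradient of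
  the periodic function \<open>Q \<circ> torus_proj\<close> at any point over \<open>p\<close>; by periodicity the
  choice of that point is immaterial.\<close>

definition torus_grad :: "('n::finite torus \<Rightarrow> real) \<Rightarrow> 'n torus \<Rightarrow> real ^ 'n" where
  "torus_grad Q p = (THE D. \<exists>x. torus_proj x = p \<and> (GDERIV (\<lambda>y. Q (torus_proj y)) x :> D))"

text \<open>\<open>D k\<close> is the \<open>k\<close>-th derivative; derivatives at boundary points of \<open>S\<close>
  are one-sided.\<close>

definition smooth_on :: "real set \<Rightarrow> (real \<Rightarrow> 'a::real_normed_vector) \<Rightarrow> bool" where
  "smooth_on S f \<longleftrightarrow>
     (\<exists>D :: nat \<Rightarrow> real \<Rightarrow> 'a. (\<forall>t\<in>S. D 0 t = f t) \<and>
        (\<forall>k. \<forall>t\<in>S. (D k has_vector_derivative D (Suc k) t) (at t within S)))"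

definition test_function :: "real set \<Rightarrow> (real \<Rightarrow> real) \<Rightarrow> bool" where
  "test_function S \<eta> \<longleftrightarrow>
     smooth_on UNIV \<eta> \<and> compact (closure {t. \<eta> t \<noteq> 0}) \<and> closure {t. \<eta> t \<noteq> 0} \<subseteq> S"

definition locally_integrable_on :: "real set \<Rightarrow> (real \<Rightarrow> 'a::euclidean_space) \<Rightarrow> bool" where
  "locally_integrable_on S f \<longleftrightarrow> (\<forall>C. compact C \<and> C \<subseteq> S \<longrightarrow> set_integrable lborel C f)"

definition has_weak_derivative_on ::
  "real set \<Rightarrow> (real \<Rightarrow> 'a::euclidean_space) \<Rightarrow> (real \<Rightarrow> 'a) \<Rightarrow> bool" where
  "has_weak_derivative_on S f g \<longleftrightarrow>
     locally_integrable_on S f \<and> locally_integrable_on S g \<and>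
     (\<forall>\<eta>. test_function S \<eta> \<longrightarrow>
        (LINT t:S|lborel. deriv \<eta> t *\<^sub>R f t) = - (LINT t:S|lborel. \<eta> t *\<^sub>R g t))"

definition square_integrable_on :: "real set \<Rightarrow> (real \<Rightarrow> 'a::euclidean_space) \<Rightarrow> bool" where
  "square_integrable_on S f \<longleftrightarrow>
     set_borel_measurable lborel S f \<and> set_integrable lborel S (\<lambda>t. (norm (f t))\<^sup>2)"

text \<open>Curves are defined on \<open>[0, \<infinity>)\<close>; their values at negative times play no role.
  Every continuous curve in the torus has a continuous lift, and two such lifts differ by a constant
  vector in \<open>2 \<pi> \<int>\<^sup>n\<close>. Regularity and derivatives of a curve are those of its continuous
  lifts.\<close>

definition is_lift :: "(real \<Rightarrow> 'n::finite torus) \<Rightarrow> (real \<Rightarrow> real ^ 'n) \<Rightarrow> bool" where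
  "is_lift \<Phi> \<phi> \<longleftrightarrow> continuous_on {0..} \<phi> \<and> (\<forall>t\<ge>0. \<Phi> t = torus_proj (\<phi> t))"

definition has_weak_velocity :: "(real \<Rightarrow> 'n::finite torus) \<Rightarrow> (real \<Rightarrow> real ^ 'n) \<Rightarrow> bool" where
  "has_weak_velocity \<Phi> v \<longleftrightarrow>
     (\<exists>\<phi>. is_lift \<Phi> \<phi> \<and>
        (\<forall>T>0. has_weak_derivative_on {0<..<T} \<phi> v \<and> square_integrable_on {0<..<T} v))"

definition H1_loc :: "(real \<Rightarrow> 'n::finite torus) set" where
  "H1_loc = {\<Phi>. \<exists>v. has_weak_velocity \<Phi> v}"

text \<open>A representative; it is unique up to a null set of \<open>(0, \<infinity>)\<close>.\<close>

definition weak_velocity :: "(real \<Rightarrow> 'n::finite torus) \<Rightarrow> real \<Rightarrow> real ^ 'n" where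
  "weak_velocity \<Phi> = (SOME v. has_weak_velocity \<Phi> v)"

definition torus_smooth :: "(real \<Rightarrow> 'n::finite torus) \<Rightarrow> bool" where
  "torus_smooth \<Phi> \<longleftrightarrow> (\<exists>\<phi>. is_lift \<Phi> \<phi> \<and> smooth_on {0..} \<phi>)"

text \<open>The classical velocity, one-sided at time \<open>0\<close>.\<close>

definition velocity :: "(real \<Rightarrow> 'n::finite torus) \<Rightarrow> real \<Rightarrow> real ^ 'n" where
  "velocity \<Phi> t =
     (THE v. \<exists>\<phi>. is_lift \<Phi> \<phi> \<and> (\<phi> has_vector_derivative v) (at t within {0..}))"

definition lagrangian :: "('n::finite torus \<Rightarrow> real) \<Rightarrow> (real \<Rightarrow> 'n torus) \<Rightarrow> real \<Rightarrow> real" where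
  "lagrangian Q \<Phi> t = 1 / 2 * (norm (weak_velocity \<Phi> t))\<^sup>2 + Q (\<Phi> t)"

definition admissible :: "('n::finite torus \<Rightarrow> real) \<Rightarrow> 'n torus \<Rightarrow> (real \<Rightarrow> 'n torus) set" where
  "admissible Q \<Phi>0 =
     {\<Phi> \<in> H1_loc. \<Phi> 0 = \<Phi>0 \<and> set_integrable lborel {0<..} (lagrangian Q \<Phi>)}"

definition action :: "('n::finite torus \<Rightarrow> real) \<Rightarrow> (real \<Rightarrow> 'n torus) \<Rightarrow> real" where
  "action Q \<Phi> = (LINT t:{0<..}|lborel. lagrangian Q \<Phi> t)"

definition energy :: "('n::finite torus \<Rightarrow> real) \<Rightarrow> (real \<Rightarrow> 'n torus) \<Rightarrow> real \<Rightarrow> real" where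
  "energy Q \<Phi> t = 1 / 2 * (norm (velocity \<Phi> t))\<^sup>2 - Q (\<Phi> t)"

end

theory Submission
  imports Defs
begin

text \<open>
  Let \<open>\<phi>\<close> be a lift of the minimizer with weak velocity \<open>w\<close>, and let \<open>F\<close> be the periodic lift of
  \<open>Q\<close>. Vanishing of the first variation in a compactly supported direction \<open>\<eta>\<close> says
  \<open>\<integral> w \<bullet> \<eta>' + \<nabla>F(\<phi>) \<bullet> \<eta> = 0\<close>. With \<open>P'' = \<nabla>F(\<phi>)\<close> and \<open>\<eta>\<close> the difference of two linear ramps,
  which rises on \<open>(0, h)\<close> and falls back to zero on \<open>(1, 2)\<close>, this becomes
  \<open>(\<phi> - P)(h) - (\<phi> - P)(0) = h ((\<phi> - P)(2) - (\<phi> - P)(1))\<close>. Hence \<open>\<phi> - P\<close> is affine and \<open>\<phi>\<close> is a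
  classical \<open>C\<^sup>2\<close> solution, without any regularity theory for \<open>w\<close>. Smoothness follows because
  the algebra generated by the components of \<open>\<phi>\<close> and \<open>\<phi>'\<close> and by the functions \<open>f \<circ> \<phi>\<close>, \<open>f\<close> real
  analytic, is closed under differentiation. The energy is a constant \<open>c\<close>, and \<open>\<bar>c\<bar>\<close> is dominated by
  the Lagrangian, which is integrable on a half-line of infinite length; so \<open>c = 0\<close>.
\<close>

subsection \<open>Partial derivatives of real analytic functions\<close>

text \<open>Ramps are used because their weak derivatives are indicators: integrated against
  \<open>w\<close> they give increments of \<open>\<phi>\<close>, so the first variation speaks of
  values of \<open>\<phi>\<close> and never of pointwise values of \<open>w\<close>. A single ramp
  does not come back to zero; the return is placed on the fixed interval (1, 2), so that it
  contributes \<open>h\<close> times a vector independent of \<open>h\<close>. Such perturbations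
  are only Lipschitz, whereas weak derivatives are defined by smooth test functions. The bridge is
  that integrals of a weak derivative are increments, and its proof needs a smooth step. Competitors
  agree with the minimizer after a finite time, so that no knowledge of its behaviour at infinity is
  required for the equation. A further obstacle is that \<open>weak_velocity\<close> is an arbitrary
  choice among representatives: the Lagrangian of a competitor is known almost everywhere only.
  Analyticity enters through one fact: the partial derivatives of a real analytic function exist and
  are again real analytic.\<close>

text \<open>Halving the radius leaves a factor \<open>(1 / 2) ^ (\<alpha> i - 1)\<close>, which
  absorbs the factor \<open>\<alpha> i\<close> brought down by differentiation: their product is at
  most 2. The missing power of \<open>s\<close> costs \<open>1 / s\<close>. The bound is free of
  \<open>y\<close> and serves as a majorant.\<close>

lemma monomial_partial_bound:
  fixes \<alpha> :: "'n::finite \<Rightarrow> nat" and y :: "'n \<Rightarrow> real"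
  assumes s: "0 < s" and y: "\<And>j. \<bar>y j\<bar> \<le> s / 2"
  shows "\<bar>real (\<alpha> i) * y i ^ (\<alpha> i - 1) * (\<Prod>j\<in>UNIV - {i}. y j ^ \<alpha> j)\<bar>
    \<le> 2 / s * (\<Prod>j\<in>UNIV. s ^ \<alpha> j)"
proof (cases "\<alpha> i")
  case 0
  then show ?thesis using s by (simp add: prod_nonneg)
next
  case (Suc m)
  have "\<bar>real (Suc m) * y i ^ m\<bar> \<le> real (Suc m) * (s / 2) ^ m"
    using y[of i] by (simp add: abs_mult power_abs power_mono del: of_nat_Suc)
  also have "\<dots> = (real (Suc m) / 2 ^ m) * s ^ m"
    by (simp add: power_divide)
  also have "\<dots> \<le> 2 * s ^ m"
  proof (rule mult_right_mono)
    have "Suc m \<le> 2 ^ Suc m" using less_exp[of "Suc m"] by linarith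
    then have "real (Suc m) \<le> 2 ^ Suc m"
      by (metis of_nat_le_iff of_nat_numeral of_nat_power)
    then show "real (Suc m) / 2 ^ m \<le> 2" by (simp add: field_simps)
  qed (use s in auto)
  finally have A: "\<bar>real (Suc m) * y i ^ m\<bar> \<le> 2 / s * s ^ Suc m"
    using s by simp
  have "\<bar>\<Prod>j\<in>UNIV - {i}. y j ^ \<alpha> j\<bar> = (\<Prod>j\<in>UNIV - {i}. \<bar>y j\<bar> ^ \<alpha> j)"
    by (simp add: abs_prod power_abs)
  also have "\<dots> \<le> (\<Prod>j\<in>UNIV - {i}. s ^ \<alpha> j)"
  proof (rule prod_mono)
    fix j
    show "0 \<le> \<bar>y j\<bar> ^ \<alpha> j \<and> \<bar>y j\<bar> ^ \<alpha> j \<le> s ^ \<alpha> j"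
      using y[of j] s by (auto intro!: power_mono)
  qed
  finally have B: "\<bar>\<Prod>j\<in>UNIV - {i}. y j ^ \<alpha> j\<bar> \<le> (\<Prod>j\<in>UNIV - {i}. s ^ \<alpha> j)" .
  have "\<bar>real (Suc m) * y i ^ m * (\<Prod>j\<in>UNIV - {i}. y j ^ \<alpha> j)\<bar>
      \<le> (2 / s * s ^ Suc m) * (\<Prod>j\<in>UNIV - {i}. s ^ \<alpha> j)"
    unfolding abs_mult[of "_ * _" "prod _ _"] using A B s by (intro mult_mono) auto
  also have "\<dots> = 2 / s * (\<Prod>j\<in>UNIV. s ^ \<alpha> j)"
    using Suc by (simp add: prod.remove[of UNIV i])
  finally show ?thesis using Suc by simp
qed

text \<open>An enumeration of the multi-indices turns the unordered sums of
  \<open>real_analytic\<close> into ordinary series, to which the Weierstrass test and termwise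
  differentiation apply.\<close>

lemma ex_bij_multi_index: "\<exists>e::nat \<Rightarrow> ('n::finite \<Rightarrow> nat). bij e"
proof -
  have "infinite (UNIV :: ('n \<Rightarrow> nat) set)"
  proof
    assume "finite (UNIV :: ('n \<Rightarrow> nat) set)"
    moreover have "inj (\<lambda>k::nat. \<lambda>_::'n. k)" by (auto simp: inj_on_def fun_eq_iff)
    ultimately have "finite (UNIV :: nat set)"
      by (metis finite_imageD finite_subset subset_UNIV)
    then show False by simp
  qed
  then show ?thesis
    using bij_betw_from_nat_into[of "UNIV :: ('n \<Rightarrow> nat) set"] by auto
qed

text \<open>Absolute convergence at one point, shifted from \<open>x0\<close> by \<open>s\<close> in
  every coordinate, majorizes the differentiated terms on a ball of radius at most
  \<open>s / 2\<close>, up to the factor \<open>2 / s\<close>. The coefficients of the partials are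
  written out because the partials have to be power series again.\<close>

lemma power_series_has_partials:
  fixes f :: "real ^ 'n::finite \<Rightarrow> real" and c :: "('n \<Rightarrow> nat) \<Rightarrow> real"
  assumes r: "0 < r"
    and f: "\<And>x. x \<in> ball x0 r \<Longrightarrow>
      ((\<lambda>\<alpha>. c \<alpha> * (\<Prod>i\<in>UNIV. (x $ i - x0 $ i) ^ \<alpha> i)) has_sum f x) UNIV"
  obtains \<rho> G where "0 < \<rho>"
    "\<And>x. x \<in> ball x0 \<rho> \<Longrightarrow> GDERIV f x :> G x"
    "\<And>x i. x \<in> ball x0 \<rho> \<Longrightarrow>
      ((\<lambda>\<alpha>. c (\<alpha>(i := \<alpha> i + 1)) * real (\<alpha> i + 1) * (\<Prod>j\<in>UNIV. (x $ j - x0 $ j) ^ \<alpha> j))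
        has_sum G x $ i) UNIV"
proof -
  \<comment> \<open>The factor \<open>CARD('n)\<close> keeps \<open>x1\<close> inside the ball: its
    distance from \<open>x0\<close> is at most the sum of the coordinate shifts, which is
    \<open>r / 2\<close>.\<close>
  define s where "s = r / (2 * real CARD('n))"
  have s: "0 < s" using r by (simp add: s_def)
  define x1 where "x1 = x0 + (\<chi> i. s)"
  have "norm (\<chi> i::'n. s) \<le> (\<Sum>i\<in>(UNIV::'n set). \<bar>s\<bar>)"
    using norm_le_l1_cart[of "\<chi> i::'n. s"] by simp
  also have "\<dots> < r" using r by (simp add: s_def)
  finally have "x1 \<in> ball x0 r" by (simp add: x1_def dist_norm)
  from f[OF this]
  have "(\<lambda>\<alpha>. c \<alpha> * (\<Prod>i\<in>UNIV. s ^ \<alpha> i)) summable_on UNIV"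
    by (auto simp: x1_def summable_on_def)
  \<comment> \<open>For real families unordered summability is absolute summability.\<close>
  then have "(\<lambda>\<alpha>. norm (c \<alpha> * (\<Prod>i\<in>UNIV. s ^ \<alpha> i))) summable_on UNIV"
    by (simp only: summable_on_iff_abs_summable_on_real[symmetric])
  then have A: "(\<lambda>\<alpha>. \<bar>c \<alpha>\<bar> * (\<Prod>i\<in>UNIV. s ^ \<alpha> i)) summable_on UNIV"
    using s by (simp add: abs_mult prod_nonneg)
  define M where "M \<alpha> = 2 / s * (\<bar>c \<alpha>\<bar> * (\<Prod>i\<in>UNIV. s ^ \<alpha> i))" for \<alpha>
  have M: "M summable_on UNIV"
    unfolding M_def by (intro summable_on_cmult_right A)
  define \<rho> where "\<rho> = min (s / 2) r"
  have \<rho>: "0 < \<rho>" using s r by (simp add: \<rho>_def)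
  have near: "\<bar>x $ j - x0 $ j\<bar> \<le> s / 2" if "x \<in> ball x0 \<rho>" for x j
    using component_le_norm_cart[of "x - x0" j] that
    by (simp add: \<rho>_def dist_norm norm_minus_commute)
  define T where "T \<alpha> i x = c \<alpha> * (real (\<alpha> i) * (x $ i - x0 $ i) ^ (\<alpha> i - 1) *
      (\<Prod>j\<in>UNIV - {i}. (x $ j - x0 $ j) ^ \<alpha> j))" for \<alpha> i and x :: "real ^ 'n"
  have TM: "norm (T \<alpha> i x) \<le> M \<alpha>" if "x \<in> ball x0 \<rho>" for \<alpha> i x
  proof -
    have "norm (T \<alpha> i x) \<le> \<bar>c \<alpha>\<bar> * (2 / s * (\<Prod>j\<in>UNIV. s ^ \<alpha> j))"
      unfolding T_def real_norm_def abs_mult[of "c _"]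
      using monomial_partial_bound[OF s near[OF that], where \<alpha>=\<alpha> and i=i]
      by (intro mult_left_mono) auto
    then show ?thesis by (simp add: M_def mult_ac)
  qed
  obtain e :: "nat \<Rightarrow> ('n \<Rightarrow> nat)" where e: "bij e" using ex_bij_multi_index by blast
  have Me: "summable (\<lambda>n. M (e n))"
    using M e by (intro summable_on_imp_summable) (simp add: summable_on_reindex_bij_betw)
  define G where "G x = (\<chi> i. \<Sum>n. T (e n) i x)" for x
  have Tsum: "((\<lambda>\<alpha>. T \<alpha> i x) has_sum G x $ i) UNIV" if "x \<in> ball x0 \<rho>" for i x
  proof -
    have n: "summable (\<lambda>n. norm (T (e n) i x))"
      by (rule summable_comparison_test[OF _ Me]) (use TM[OF that] in auto)
    then have "(\<lambda>n. T (e n) i x) sums (G x $ i)"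
      by (simp add: G_def summable_norm_cancel summable_sums)
    with n have "((\<lambda>n. T (e n) i x) has_sum G x $ i) UNIV"
      by (rule norm_summable_imp_has_sum)
    then show ?thesis using has_sum_reindex_bij_betw[OF e, of "\<lambda>\<alpha>. T \<alpha> i x"] by simp
  qed
  define K where "K n x = c (e n) * (\<Prod>i\<in>UNIV. (x $ i - x0 $ i) ^ e n i)" for n x
  have Kf: "(\<lambda>n. K n x) sums f x" if "x \<in> ball x0 \<rho>" for x
  proof -
    have "x \<in> ball x0 r" using that by (simp add: \<rho>_def)
    from f[OF this] show ?thesis
      unfolding K_def
      by (intro has_sum_imp_sums)
        (use has_sum_reindex_bij_betw[OF e, of "\<lambda>\<alpha>. c \<alpha> * (\<Prod>i\<in>UNIV. (x $ i - x0 $ i) ^ \<alpha> i)"] in simp)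
  qed
  have K': "(K n has_derivative (\<lambda>h. \<Sum>i\<in>UNIV. T (e n) i x * h $ i)) (at x within S)" for n x S
  proof -
    have "((\<lambda>x. x $ i - x0 $ i) has_derivative (\<lambda>h. h $ i)) (at x within S)" for i
      by (auto intro!: derivative_eq_intros bounded_linear.has_derivative[OF bounded_linear_vec_nth])
    from has_derivative_power[OF this]
    have "((\<lambda>x. (x $ i - x0 $ i) ^ e n i) has_derivative
        (\<lambda>h. of_nat (e n i) * h $ i * (x $ i - x0 $ i) ^ (e n i - 1))) (at x within S)" for i .
    then have "((\<lambda>x. \<Prod>i\<in>UNIV. (x $ i - x0 $ i) ^ e n i) has_derivative
        (\<lambda>h. \<Sum>i\<in>UNIV. of_nat (e n i) * h $ i * (x $ i - x0 $ i) ^ (e n i - 1) *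
          (\<Prod>j\<in>UNIV - {i}. (x $ j - x0 $ j) ^ e n j))) (at x within S)"
      by (intro has_derivative_prod)
    from has_derivative_mult_right[OF this, of "c (e n)"]
    show ?thesis
      unfolding K_def T_def sum_distrib_left by (simp add: mult_ac)
  qed
  have "\<exists>g. \<forall>x\<in>ball x0 \<rho>. (\<lambda>n. K n x) sums g x \<and>
      (g has_derivative (\<lambda>h. \<Sum>i\<in>UNIV. G x $ i * h $ i)) (at x within ball x0 \<rho>)"
  proof (rule has_derivative_series[OF convex_ball K'])
    show "x0 \<in> ball x0 \<rho>" using \<rho> by simp
    then show "(\<lambda>n. K n x0) sums f x0" by (rule Kf)
    fix \<epsilon> :: real assume \<epsilon>: "0 < \<epsilon>"
    \<comment> \<open>The error is divided evenly among the components of the gradient; finitely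
      many of them are eventually within \<open>\<delta>\<close> simultaneously.\<close>
    define \<delta> where "\<delta> = \<epsilon> / real CARD('n)"
    have \<delta>: "0 < \<delta>" using \<epsilon> by (simp add: \<delta>_def)
    have "\<forall>\<^sub>F n in sequentially. \<forall>x\<in>ball x0 \<rho>. dist (\<Sum>k<n. T (e k) i x) (G x $ i) < \<delta>" for i
    proof -
      have "uniform_limit (ball x0 \<rho>) (\<lambda>n x. \<Sum>k<n. T (e k) i x) (\<lambda>x. \<Sum>k. T (e k) i x) sequentially"
        by (rule Weierstrass_m_test[OF _ Me]) (rule TM)
      from uniform_limitD[OF this \<delta>] show ?thesis by (simp add: G_def)
    qed
    then have "\<forall>\<^sub>F n in sequentially. \<forall>i. \<forall>x\<in>ball x0 \<rho>. dist (\<Sum>k<n. T (e k) i x) (G x $ i) < \<delta>"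
      by (intro eventually_all_finite) auto
    then show "\<forall>\<^sub>F n in sequentially. \<forall>x\<in>ball x0 \<rho>. \<forall>h.
        norm ((\<Sum>k<n. \<Sum>i\<in>UNIV. T (e k) i x * h $ i) - (\<Sum>i\<in>UNIV. G x $ i * h $ i)) \<le> \<epsilon> * norm h"
    proof (rule eventually_mono, intro ballI allI)
      fix n x and h :: "real ^ 'n"
      assume H: "\<forall>i. \<forall>x\<in>ball x0 \<rho>. dist (\<Sum>k<n. T (e k) i x) (G x $ i) < \<delta>" and x: "x \<in> ball x0 \<rho>"
      have "(\<Sum>k<n. \<Sum>i\<in>UNIV. T (e k) i x * h $ i) - (\<Sum>i\<in>UNIV. G x $ i * h $ i)
          = (\<Sum>i\<in>UNIV. ((\<Sum>k<n. T (e k) i x) - G x $ i) * h $ i)"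
        by (subst sum.swap) (simp add: sum_subtractf sum_distrib_right left_diff_distrib)
      also have "norm \<dots> \<le> (\<Sum>i\<in>(UNIV::'n set). \<delta> * norm h)"
      proof (rule sum_norm_le)
        fix i
        show "norm (((\<Sum>k<n. T (e k) i x) - G x $ i) * h $ i) \<le> \<delta> * norm h"
          unfolding norm_mult
          by (intro mult_mono) (use H x \<delta> component_le_norm_cart[of h i] in \<open>auto simp: dist_norm intro: less_imp_le\<close>)
      qed
      also have "\<dots> = \<epsilon> * norm h" by (simp add: \<delta>_def)
      finally show "norm ((\<Sum>k<n. \<Sum>i\<in>UNIV. T (e k) i x * h $ i) - (\<Sum>i\<in>UNIV. G x $ i * h $ i)) \<le> \<epsilon> * norm h" .
    qed
  qed
  then obtain g where g: "\<And>x. x \<in> ball x0 \<rho> \<Longrightarrow> (\<lambda>n. K n x) sums g x"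
    "\<And>x. x \<in> ball x0 \<rho> \<Longrightarrow> (g has_derivative (\<lambda>h. \<Sum>i\<in>UNIV. G x $ i * h $ i)) (at x within ball x0 \<rho>)"
    by blast
  show thesis
  proof (rule that[OF \<rho>])
    fix x assume x: "x \<in> ball x0 \<rho>"
    have "(f has_derivative (\<lambda>h. \<Sum>i\<in>UNIV. G x $ i * h $ i)) (at x within ball x0 \<rho>)"
      by (rule has_derivative_transform[OF x _ g(2)[OF x]]) (metis Kf g(1) sums_unique2)
    then show "GDERIV f x :> G x"
      using x by (simp add: gderiv_def inner_vec_def mult.commute at_within_open[OF x])
  next
    fix x i assume x: "x \<in> ball x0 \<rho>"
    \<comment> \<open>The differentiated term for \<alpha> has exponent
      \<open>\<alpha> i - 1\<close> in coordinate \<open>i\<close>. Terms with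
      \<open>\<alpha> i = 0\<close> vanish, so the sum lives on the range of the injective shift
      \<open>?h\<close>, and reindexing along it restores the standard form of a power
      series.\<close>
    let ?h = "\<lambda>\<alpha>::'n \<Rightarrow> nat. \<alpha>(i := \<alpha> i + 1)"
    have inj: "inj ?h"
    proof (rule injI)
      fix \<alpha> \<beta> :: "'n \<Rightarrow> nat" assume "?h \<alpha> = ?h \<beta>"
      then have "\<alpha> j = \<beta> j" for j by (cases "j = i") (auto dest: fun_cong[of _ _ j])
      then show "\<alpha> = \<beta>" by auto
    qed
    have "\<alpha> \<in> range ?h" if "\<alpha> i \<noteq> 0" for \<alpha>
      using that by (intro range_eqI[of _ _ "\<alpha>(i := \<alpha> i - 1)"]) auto
    then have "((\<lambda>\<alpha>. T \<alpha> i x) has_sum G x $ i) (range ?h)"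
      using Tsum[OF x, of i]
      by (subst has_sum_cong_neutral[where T=UNIV and g="\<lambda>\<alpha>. T \<alpha> i x"]) (auto simp: T_def)
    then have *: "((\<lambda>\<alpha>. T (?h \<alpha>) i x) has_sum G x $ i) UNIV"
      unfolding has_sum_reindex[OF inj] o_def .
    have "T (?h \<alpha>) i x = c (?h \<alpha>) * real (\<alpha> i + 1) * (\<Prod>j\<in>UNIV. (x $ j - x0 $ j) ^ \<alpha> j)" for \<alpha>
    proof -
      have "(\<Prod>j\<in>UNIV - {i}. (x $ j - x0 $ j) ^ ?h \<alpha> j) = (\<Prod>j\<in>UNIV - {i}. (x $ j - x0 $ j) ^ \<alpha> j)"
        by (rule prod.cong) auto
      then show ?thesis
        using prod.remove[of UNIV i "\<lambda>j. (x $ j - x0 $ j) ^ \<alpha> j"] by (simp add: T_def)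
    qed
    with * show "((\<lambda>\<alpha>. c (?h \<alpha>) * real (\<alpha> i + 1) * (\<Prod>j\<in>UNIV. (x $ j - x0 $ j) ^ \<alpha> j))
        has_sum G x $ i) UNIV" by simp
  qed
qed

lemma GDERIV_unique: "GDERIV f x :> D \<Longrightarrow> GDERIV f x :> E \<Longrightarrow> D = E"
  unfolding gderiv_def
  by (drule (1) has_derivative_unique) (simp add: fun_eq_iff vector_eq_ldot)

text \<open>The series for the gradient is available near each point only, with coefficients that
  depend on the point; uniqueness of gradients glues the local gradients to one \<open>G\<close>.
  The second conclusion makes the lemma repeatable, as the bootstrap for smoothness
  requires.\<close>

lemma real_analytic_partials:
  fixes f :: "real ^ 'n::finite \<Rightarrow> real"
  assumes "real_analytic f"
  obtains G where "\<And>x. GDERIV f x :> G x" "\<And>i. real_analytic (\<lambda>x. G x $ i)"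
proof -
  have loc: "\<exists>r>0. \<exists>c H. \<forall>x\<in>ball x0 r. GDERIV f x :> H x \<and> (\<forall>i.
      ((\<lambda>\<alpha>. c i \<alpha> * (\<Prod>j\<in>UNIV. (x $ j - x0 $ j) ^ \<alpha> j)) has_sum H x $ i) UNIV)" for x0
  proof -
    obtain r c where "0 < r" "\<And>x. x \<in> ball x0 r \<Longrightarrow>
        ((\<lambda>\<alpha>. c \<alpha> * (\<Prod>i\<in>UNIV. (x $ i - x0 $ i) ^ \<alpha> i)) has_sum f x) UNIV"
      using assms unfolding real_analytic_def by meson
    from power_series_has_partials[OF this] obtain \<rho> H where "0 < \<rho>"
      "\<And>x. x \<in> ball x0 \<rho> \<Longrightarrow> GDERIV f x :> H x"
      "\<And>x i. x \<in> ball x0 \<rho> \<Longrightarrow>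
        ((\<lambda>\<alpha>. c (\<alpha>(i := \<alpha> i + 1)) * real (\<alpha> i + 1) * (\<Prod>j\<in>UNIV. (x $ j - x0 $ j) ^ \<alpha> j))
          has_sum H x $ i) UNIV" by blast
    then show ?thesis
      by (intro exI[of _ \<rho>] conjI exI[of _ "\<lambda>i \<alpha>. c (\<alpha>(i := \<alpha> i + 1)) * real (\<alpha> i + 1)"] exI[of _ H]) auto
  qed
  have "\<exists>D. GDERIV f x :> D" for x
    using loc[of x] by (metis centre_in_ball)
  then obtain G where G: "\<And>x. GDERIV f x :> G x" by metis
  show thesis
  proof (rule that[OF G])
    fix i
    show "real_analytic (\<lambda>x. G x $ i)"
      unfolding real_analytic_def
    proof
      fix x0
      obtain r c H where r: "r > 0" and H: "\<forall>x\<in>ball x0 r. GDERIV f x :> H x \<and> (\<forall>i.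
          ((\<lambda>\<alpha>. c i \<alpha> * (\<Prod>j\<in>UNIV. (x $ j - x0 $ j) ^ \<alpha> j)) has_sum H x $ i) UNIV)"
        using loc[of x0] by (elim exE conjE) (rule that)
      have "((\<lambda>\<alpha>. c i \<alpha> * (\<Prod>j\<in>UNIV. (x $ j - x0 $ j) ^ \<alpha> j)) has_sum G x $ i) UNIV"
        if x: "x \<in> ball x0 r" for x
      proof -
        note Hx = H[rule_format, OF x]
        have "H x = G x" by (rule GDERIV_unique[OF conjunct1[OF Hx] G])
        then show ?thesis using conjunct2[OF Hx, rule_format, of i] by simp
      qed
      then show "\<exists>r>0. \<exists>c. \<forall>x\<in>ball x0 r.
          ((\<lambda>\<alpha>. c \<alpha> * (\<Prod>j\<in>UNIV. (x $ j - x0 $ j) ^ \<alpha> j)) has_sum G x $ i) UNIV"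
        by (intro exI[of _ r] conjI r exI[of _ "c i"] ballI)
    qed
  qed
qed

subsection \<open>Algebras of functions closed under differentiation\<close>

text \<open>A choice function for derivatives that stays inside \<open>X\<close> can be iterated,
  and its iterates are the chain that \<open>smooth_on\<close> asks for. No formula for a higher
  derivative is ever needed.\<close>

lemma smooth_on_if_closed_under_derivative:
  assumes X: "\<And>f. f \<in> X \<Longrightarrow> \<exists>g\<in>X. \<forall>t\<in>S. (f has_vector_derivative g t) (at t within S)"
    and f: "f \<in> X"
  shows "smooth_on S f"
proof -
  obtain d where d: "\<And>f. f \<in> X \<Longrightarrow> d f \<in> X"
    "\<And>f t. f \<in> X \<Longrightarrow> t \<in> S \<Longrightarrow> (f has_vector_derivative d f t) (at t within S)"
    using X by metis
  have "(d ^^ k) f \<in> X" for k by (induction k) (auto simp: f d)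
  then show ?thesis
    unfolding smooth_on_def by (intro exI[of _ "\<lambda>k. (d ^^ k) f"]) (auto intro: d)
qed

text \<open>The derivative of a generator is in general a polynomial in generators. Closing under
  sums and products keeps it in the set and makes the Leibniz rule stay there too;
  \<open>zero\<close> provides the empty sum.\<close>

inductive_set fun_algebra :: "(real \<Rightarrow> real) set \<Rightarrow> (real \<Rightarrow> real) set" for B where
  base: "f \<in> B \<Longrightarrow> f \<in> fun_algebra B"
| zero: "(\<lambda>t. 0) \<in> fun_algebra B"
| add: "f \<in> fun_algebra B \<Longrightarrow> g \<in> fun_algebra B \<Longrightarrow> (\<lambda>t. f t + g t) \<in> fun_algebra B"
| mult: "f \<in> fun_algebra B \<Longrightarrow> g \<in> fun_algebra B \<Longrightarrow> (\<lambda>t. f t * g t) \<in> fun_algebra B"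

lemma fun_algebra_sum:
  "(\<And>i. i \<in> I \<Longrightarrow> f i \<in> fun_algebra B) \<Longrightarrow> (\<lambda>t. \<Sum>i\<in>I. f i t) \<in> fun_algebra B"
  by (induction I rule: infinite_finite_induct) (auto intro: fun_algebra.intros)

lemma fun_algebra_closed_under_derivative:
  assumes B: "\<And>f. f \<in> B \<Longrightarrow>
      \<exists>g\<in>fun_algebra B. \<forall>t\<in>S. (f has_vector_derivative g t) (at t within S)"
    and "f \<in> fun_algebra B"
  shows "\<exists>g\<in>fun_algebra B. \<forall>t\<in>S. (f has_vector_derivative g t) (at t within S)"
  using assms(2)
proof induction
  case (base f)
  then show ?case by (rule B)
next
  case zero
  show ?case by (rule bexI[OF _ fun_algebra.zero]) simp
next
  case (add f g)
  then obtain f' g' where fg: "f' \<in> fun_algebra B" "g' \<in> fun_algebra B"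
    "\<forall>t\<in>S. (f has_vector_derivative f' t) (at t within S)"
    "\<forall>t\<in>S. (g has_vector_derivative g' t) (at t within S)" by blast
  show ?case
    by (rule bexI[OF _ fun_algebra.add[OF fg(1,2)]]) (use fg in \<open>auto intro: has_vector_derivative_add\<close>)
next
  case (mult f g)
  then obtain f' g' where fg: "f' \<in> fun_algebra B" "g' \<in> fun_algebra B"
    "\<forall>t\<in>S. (f has_vector_derivative f' t) (at t within S)"
    "\<forall>t\<in>S. (g has_vector_derivative g' t) (at t within S)" by blast
  show ?case
    by (rule bexI[OF _ fun_algebra.add[OF fun_algebra.mult[OF mult.hyps(1) fg(2)] fun_algebra.mult[OF fg(1) mult.hyps(2)]]])
      (use fg in \<open>auto intro: has_vector_derivative_mult\<close>)
qed

text \<open>Derivatives are taken componentwise, so the vector functions with all components in the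
  algebra are themselves closed under differentiation.\<close>

lemma smooth_on_vec_fun_algebra:
  fixes f :: "real \<Rightarrow> real ^ 'n::finite"
  assumes B: "\<And>f. f \<in> B \<Longrightarrow>
      \<exists>g\<in>fun_algebra B. \<forall>t\<in>S. (f has_vector_derivative g t) (at t within S)"
    and f: "\<And>i. (\<lambda>t. f t $ i) \<in> fun_algebra B"
  shows "smooth_on S f"
proof (rule smooth_on_if_closed_under_derivative[where X="{f. \<forall>i. (\<lambda>t. f t $ i) \<in> fun_algebra B}"])
  fix h :: "real \<Rightarrow> real ^ 'n" assume "h \<in> {f. \<forall>i. (\<lambda>t. f t $ i) \<in> fun_algebra B}"
  then have "\<forall>i. \<exists>g\<in>fun_algebra B. \<forall>t\<in>S. ((\<lambda>t. h t $ i) has_vector_derivative g t) (at t within S)"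
    using fun_algebra_closed_under_derivative[OF B] by blast
  then obtain g where g: "\<And>i. g i \<in> fun_algebra B"
    "\<And>i t. t \<in> S \<Longrightarrow> ((\<lambda>t. h t $ i) has_vector_derivative g i t) (at t within S)" by metis
  have "(h has_vector_derivative (\<chi> i. g i t)) (at t within S)" if "t \<in> S" for t
    unfolding has_vector_derivative_def
    by (subst has_derivative_componentwise_within)
      (use g(2)[OF that] in \<open>auto simp: Basis_vec_def inner_axis has_vector_derivative_def\<close>)
  with g(1) show "\<exists>g\<in>{f. \<forall>i. (\<lambda>t. f t $ i) \<in> fun_algebra B}. \<forall>t\<in>S. (h has_vector_derivative g t) (at t within S)"
    by (intro bexI[of _ "\<lambda>t. \<chi> i. g i t"]) auto
qed (use f in auto)

subsection \<open>Smooth step functions\<close>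

text \<open>The classical flat function \<open>exp (- (1 / x))\<close>, with a polynomial parameter
  so that the family is closed under differentiation. For \<open>y = 1 / x\<close> the chain rule
  gives \<open>d/dx = - y^2 d/dy\<close>, hence \<open>p\<close> becomes
  \<open>y^2 * (p - pderiv p)\<close>; the polynomial \<open>[:0, 0, 1:]\<close> is
  \<open>y^2\<close>.\<close>

definition flat_exp :: "real poly \<Rightarrow> real \<Rightarrow> real" where
  "flat_exp p x = (if x > 0 then poly p (1 / x) * exp (- (1 / x)) else 0)"

lemma flat_exp_minus: "flat_exp (- p) x = - flat_exp p x"
  by (simp add: flat_exp_def)

lemma poly_exp_minus_tendsto_0: "((\<lambda>y::real. poly p y * exp (- y)) \<longlongrightarrow> 0) at_top"
proof -
  have "((\<lambda>y. \<Sum>i\<le>degree p. coeff p i * (y ^ i / exp y)) \<longlongrightarrow> (\<Sum>i\<le>degree p. coeff p i * 0)) at_top"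
    by (intro tendsto_intros tendsto_power_div_exp_0)
  then show ?thesis
    by (simp add: poly_altdef sum_distrib_left exp_minus divide_inverse mult_ac)
qed

lemma flat_exp_has_derivative:
  "(flat_exp p has_real_derivative flat_exp ([:0, 0, 1:] * (p - pderiv p)) x) (at x)"
proof -
  consider "x > 0" | "x < 0" | "x = 0" by linarith
  then show ?thesis
  proof cases
    case 1
    have "((\<lambda>x. poly p (1 / x) * exp (- (1 / x))) has_real_derivative
        flat_exp ([:0, 0, 1:] * (p - pderiv p)) x) (at x)"
      using 1 by (auto intro!: derivative_eq_intros simp: flat_exp_def power2_eq_square field_simps)
    then show ?thesis
      by (rule has_field_derivative_transform_within_open[where S="{0<..}"])
        (use 1 in \<open>auto simp: flat_exp_def\<close>)
  next
    case 2
    have "((\<lambda>x. 0) has_real_derivative flat_exp ([:0, 0, 1:] * (p - pderiv p)) x) (at x)"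
      using 2 by (simp add: flat_exp_def)
    then show ?thesis
      by (rule has_field_derivative_transform_within_open[where S="{..<0}"])
        (use 2 in \<open>auto simp: flat_exp_def\<close>)
  next
    case 3
    have "((\<lambda>y. flat_exp p y / y) \<longlongrightarrow> 0) (at_left 0)"
      by (rule tendsto_eventually) (auto simp: flat_exp_def eventually_at_filter)
    moreover have "((\<lambda>y. flat_exp p y / y) \<longlongrightarrow> 0) (at_right 0)"
    proof (rule Lim_transform_eventually)
      \<comment> \<open>Dividing by \<open>y\<close> multiplies the polynomial by its argument
        \<open>inverse y\<close>, so the difference quotient from the right is an expression of the
        same decaying kind.\<close>
      show "((\<lambda>y. poly ([:0, 1:] * p) (inverse y) * exp (- inverse y)) \<longlongrightarrow> 0) (at_right (0::real))"
        by (rule filterlim_compose[OF poly_exp_minus_tendsto_0 filterlim_inverse_at_top_right])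
      show "\<forall>\<^sub>F y in at_right 0. poly ([:0, 1:] * p) (inverse y) * exp (- inverse y) = flat_exp p y / y"
        by (auto simp: flat_exp_def eventually_at_filter field_simps)
    qed
    ultimately have "((\<lambda>y. flat_exp p y / y) \<longlongrightarrow> 0) (at 0)"
      by (rule filterlim_split_at)
    then show ?thesis
      using 3 by (simp add: has_field_derivative_iff flat_exp_def)
  qed
qed

text \<open>The witness is the product of \<open>flat_exp 1\<close> and its reflection in the point
  1/2. Both families, \<open>flat_exp p x\<close> and \<open>flat_exp p (1 - x)\<close>, are
  preserved by differentiation, so the algebra they generate contains every derivative of the
  product.\<close>

lemma smooth_bump:
  obtains b :: "real \<Rightarrow> real" where "smooth_on UNIV b" "\<And>x. 0 \<le> b x"
    "\<And>x. x \<in> {0<..<1} \<Longrightarrow> 0 < b x" "\<And>x. x \<notin> {0<..<1} \<Longrightarrow> b x = 0"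
proof
  define B where "B = range flat_exp \<union> range (\<lambda>p x. flat_exp p (1 - x))"
  let ?b = "\<lambda>x. flat_exp 1 x * flat_exp 1 (1 - x)"
  show "smooth_on UNIV ?b"
  proof (rule smooth_on_if_closed_under_derivative[OF fun_algebra_closed_under_derivative])
    show "?b \<in> fun_algebra B"
      by (intro fun_algebra.mult fun_algebra.base) (auto simp: B_def)
    fix f assume "f \<in> B"
    then consider p where "f = flat_exp p" | p where "f = (\<lambda>x. flat_exp p (1 - x))"
      by (auto simp: B_def)
    then show "\<exists>g\<in>fun_algebra B. \<forall>t\<in>UNIV. (f has_vector_derivative g t) (at t)"
    proof cases
      case 1
      show ?thesis
        unfolding 1 has_real_derivative_iff_has_vector_derivative[symmetric]
        by (intro bexI[of _ "flat_exp ([:0, 0, 1:] * (p - pderiv p))"] ballI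
            flat_exp_has_derivative fun_algebra.base) (auto simp: B_def)
    next
      case 2
      have "((\<lambda>x. flat_exp p (1 - x)) has_real_derivative
          flat_exp (- ([:0, 0, 1:] * (p - pderiv p))) (1 - x)) (at x)" for x
      proof -
        have "((\<lambda>x. 1 - x) has_real_derivative -1) (at x)"
          by (auto intro!: derivative_eq_intros)
        from DERIV_chain2[OF flat_exp_has_derivative this, of p] show ?thesis
          by (simp only: flat_exp_minus mult_minus1_right)
      qed
      then show ?thesis
        unfolding 2 has_real_derivative_iff_has_vector_derivative[symmetric]
        by (intro bexI[of _ "\<lambda>x. flat_exp (- ([:0, 0, 1:] * (p - pderiv p))) (1 - x)"] ballI fun_algebra.base)
          (auto simp: B_def)
    qed
  qed
qed (auto simp: flat_exp_def)

lemma smooth_on_UNIV_continuous: "smooth_on UNIV f \<Longrightarrow> continuous_on A f"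
  unfolding smooth_on_def
  by (metis UNIV_I continuous_at_imp_continuous_on ext has_vector_derivative_continuous)

text \<open>\<open>H\<close> is the primitive of the bump divided by its mass. The density
  \<open>h\<close> is exposed as well, because its rescalings act as approximate point
  masses.\<close>

lemma smooth_step:
  obtains H h :: "real \<Rightarrow> real" where "smooth_on UNIV H" "continuous_on UNIV h"
    "\<And>x. (H has_real_derivative h x) (at x)" "\<And>x. 0 \<le> h x"
    "\<And>x. x \<le> 0 \<Longrightarrow> H x = 0" "\<And>x. 1 \<le> x \<Longrightarrow> H x = 1"
    "\<And>x. x \<notin> {0<..<1} \<Longrightarrow> h x = 0"
proof -
  obtain b :: "real \<Rightarrow> real" where b: "smooth_on UNIV b" "\<And>x. 0 \<le> b x"
    "\<And>x. x \<in> {0<..<1} \<Longrightarrow> 0 < b x" "\<And>x. x \<notin> {0<..<1} \<Longrightarrow> b x = 0"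
    using smooth_bump by blast
  have cb: "continuous_on A b" for A by (rule smooth_on_UNIV_continuous[OF b(1)])
  have ib: "b integrable_on {c..d}" for c d by (rule integrable_continuous_real[OF cb])
  define I where "I = integral {0..1} b"
  have I: "0 < I"
  proof -
    have "I \<noteq> 0"
      using integral_eq_0_iff[of 0 1 b] cb b(2) b(3)[of "1/2"] by (auto simp: I_def)
    moreover have "0 \<le> I" unfolding I_def by (intro integral_nonneg ib b(2))
    ultimately show ?thesis by simp
  qed
  define H where "H x = integral {0..x} b / I" for x
  have H': "(H has_real_derivative b x / I) (at x)" for x
  proof (cases "x < 0")
    case True
    have "((\<lambda>x. 0) has_real_derivative b x / I) (at x)"
      using True b(4)[of x] by simp
    then show ?thesis
      by (rule has_field_derivative_transform_within_open[where S="{..<0}"])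
        (use True in \<open>auto simp: H_def\<close>)
  next
    case False
    \<comment> \<open>Starting the integral at -1 makes 0 an interior point. Its values are
      unaffected, since the bump vanishes on [-1, 0].\<close>
    have "((\<lambda>y. integral {-1..y} b) has_real_derivative b x) (at x within {-1..x+1})"
      using False by (intro integral_has_real_derivative cb) auto
    then have "((\<lambda>y. integral {-1..y} b) has_real_derivative b x) (at x)"
      using False by (simp add: at_within_Icc_at)
    then have "((\<lambda>y. integral {-1..y} b / I) has_real_derivative b x / I) (at x)"
      by (rule DERIV_cdivide)
    then show ?thesis
    proof (rule has_field_derivative_transform_within_open[where S="{-1<..}"])
      fix y :: real assume y: "y \<in> {-1<..}"
      show "integral {-1..y} b / I = H y"
      proof (cases "y \<le> 0")
        case True
        have "integral {-1..y} b = integral {-1..y} (\<lambda>_. 0)"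
          by (rule Henstock_Kurzweil_Integration.integral_cong) (use True b(4) in auto)
        moreover have "integral {0..y} b = 0"
          using True by (cases "y = 0") auto
        ultimately show ?thesis by (simp add: H_def)
      next
        case False
        have "integral {-1..0} b = integral {-1..0} (\<lambda>_::real. 0)"
          by (rule Henstock_Kurzweil_Integration.integral_cong) (use b(4) in auto)
        moreover have "integral {-1..0} b + integral {0..y} b = integral {-1..y} b"
          by (rule Henstock_Kurzweil_Integration.integral_combine) (use False ib in auto)
        ultimately show ?thesis by (simp add: H_def)
      qed
    qed (use False in auto)
  qed
  obtain D where D: "\<And>t. D 0 t = b t" "\<And>k t. (D k has_vector_derivative D (Suc k) t) (at t)"
    using b(1) unfolding smooth_on_def by auto
  have DI: "((\<lambda>t. D k t / I) has_vector_derivative D (Suc k) t / I) (at t)" for k t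
    using has_vector_derivative_divide[OF D(2)] by blast
  have "smooth_on UNIV H"
    unfolding smooth_on_def
  \<comment> \<open>From order one on, the derivatives of \<open>H\<close> are those of the bump,
    shifted by one index and divided by the mass \<open>I\<close>.\<close>
  proof (intro exI[of _ "\<lambda>k. case k of 0 \<Rightarrow> H | Suc j \<Rightarrow> (\<lambda>t. D j t / I)"] conjI ballI allI)
    fix k t
    show "((case k of 0 \<Rightarrow> H | Suc j \<Rightarrow> (\<lambda>t. D j t / I)) has_vector_derivative
        (case Suc k of 0 \<Rightarrow> H | Suc j \<Rightarrow> (\<lambda>t. D j t / I)) t) (at t)"
      using H'[of t] DI
      by (cases k) (auto simp: D(1) has_real_derivative_iff_has_vector_derivative)
  qed simp
  moreover have "H x = 0" if "x \<le> 0" for x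
    using that by (cases "x = 0") (auto simp: H_def)
  moreover have "H x = 1" if "1 \<le> x" for x
  proof -
    have "integral {1..x} b = integral {1..x} (\<lambda>_. 0)"
      by (rule Henstock_Kurzweil_Integration.integral_cong) (use b(4) in auto)
    moreover have "integral {0..1} b + integral {1..x} b = integral {0..x} b"
      by (rule Henstock_Kurzweil_Integration.integral_combine) (use that ib in auto)
    ultimately show ?thesis using I by (simp add: H_def I_def)
  qed
  moreover have "continuous_on UNIV (\<lambda>x. b x / I)"
    using I by (intro continuous_intros cb) auto
  ultimately show thesis
    using that[of H "\<lambda>x. b x / I"] H' b(2,4) I by (auto simp: less_imp_le)
qed

subsection \<open>Weak derivatives\<close>

lemma smooth_on_diff_affine:
  assumes "smooth_on UNIV H"
  shows "smooth_on UNIV (\<lambda>x. H (k * (x - s)) - H (k * (x - t)) :: real)"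
proof -
  obtain D where D: "\<And>t. D 0 t = H t" "\<And>k t. (D k has_real_derivative D (Suc k) t) (at t)"
    using assms unfolding smooth_on_def has_real_derivative_iff_has_vector_derivative by auto
  have "((\<lambda>x. k ^ j * (D j (k * (x - s)) - D j (k * (x - t)))) has_real_derivative
      k ^ Suc j * (D (Suc j) (k * (x - s)) - D (Suc j) (k * (x - t)))) (at x)" for j x
    by (rule derivative_eq_intros DERIV_chain2[OF D(2)] refl | simp)+ (simp add: algebra_simps)
  then show ?thesis
    unfolding smooth_on_def has_real_derivative_iff_has_vector_derivative[symmetric]
    by (intro exI[of _ "\<lambda>j x. k ^ j * (D j (k * (x - s)) - D j (k * (x - t)))"]) (auto simp: D(1))
qed

text \<open>The kernel \<open>real k * h (real k * (x - s))\<close> has mass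
  \<open>H 1 - H 0 = 1\<close> and lives on [s, s + 1/k], so it averages \<open>f\<close> over
  shorter and shorter intervals to the right of \<open>s\<close>. Integrability is claimed for large
  \<open>k\<close> only, when this interval fits into (0, T).\<close>

lemma mollified_at_point:
  fixes f :: "real \<Rightarrow> 'a::euclidean_space"
  assumes h: "continuous_on UNIV h" "\<And>x. (H has_real_derivative h x) (at x)" "\<And>x. 0 \<le> h x"
    "H 0 = (0::real)" "H 1 = 1" "\<And>x. x \<notin> {0<..<1} \<Longrightarrow> h x = 0"
    and f: "continuous_on {0<..<T} f" and s: "0 < s" "s < T"
  shows "\<forall>\<^sub>F k in sequentially.
      set_integrable lborel {0<..<T} (\<lambda>x. (real k * h (real k * (x - s))) *\<^sub>R f x)"
    and "(\<lambda>k. LINT x:{0<..<T}|lborel. (real k * h (real k * (x - s))) *\<^sub>R f x) \<longlonglongrightarrow> f s"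
proof -
  define g where "g k x = real k * h (real k * (x - s))" for k :: nat and x
  have cg: "continuous_on A (g k)" for A k
    unfolding g_def by (intro continuous_intros continuous_on_compose2[OF h(1)]) auto
  have g0: "g k x = 0" if "x \<notin> {s..s + 1 / real k}" for k x
  proof (cases "k = 0")
    case False
    then have "real k * (x - s) \<notin> {0<..<1}" using that by (auto simp: field_simps zero_less_mult_iff)
    then show ?thesis by (simp add: g_def h(6))
  qed (simp add: g_def)
  have "\<forall>\<^sub>F k in sequentially. 1 / real k < \<delta>" if "0 < \<delta>" for \<delta> :: real
    using that by real_asymp
  then have small: "\<forall>\<^sub>F k in sequentially. 0 < k \<and> 1 / real k < \<delta>" if "0 < \<delta>" for \<delta> :: real
    using that eventually_gt_at_top[of "0::nat"] by (simp add: eventually_conj)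
  have int: "set_integrable lborel {0<..<T} (\<lambda>x. g k x *\<^sub>R f x)"
    "continuous_on {s..s + 1 / real k} f"
    "(LINT x:{0<..<T}|lborel. g k x *\<^sub>R f x) = integral {s..s + 1 / real k} (\<lambda>x. g k x *\<^sub>R f x)"
    if k: "0 < k \<and> 1 / real k < T - s" for k
  proof -
    have sub: "{s..s + 1 / real k} \<subseteq> {0<..<T}" using k s by auto
    then show cf: "continuous_on {s..s + 1 / real k} f" using f continuous_on_subset by blast
    have eq: "indicator {0<..<T} x *\<^sub>R (g k x *\<^sub>R f x)
        = indicator {s..s + 1 / real k} x *\<^sub>R (g k x *\<^sub>R f x)" for x
      using sub g0[of x k] by (auto simp: indicator_def)
    have i: "set_integrable lborel {s..s + 1 / real k} (\<lambda>x. g k x *\<^sub>R f x)"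
      by (intro borel_integrable_atLeastAtMost' continuous_intros cg cf)
    show "set_integrable lborel {0<..<T} (\<lambda>x. g k x *\<^sub>R f x)"
      using i unfolding set_integrable_def eq .
    show "(LINT x:{0<..<T}|lborel. g k x *\<^sub>R f x) = integral {s..s + 1 / real k} (\<lambda>x. g k x *\<^sub>R f x)"
      using set_borel_integral_eq_integral(2)[OF i] unfolding set_lebesgue_integral_def eq .
  qed
  show "\<forall>\<^sub>F k in sequentially.
      set_integrable lborel {0<..<T} (\<lambda>x. (real k * h (real k * (x - s))) *\<^sub>R f x)"
    using small[of "T - s"] s int(1) unfolding g_def by (auto elim: eventually_mono)
  have "(\<lambda>k. LINT x:{0<..<T}|lborel. g k x *\<^sub>R f x) \<longlonglongrightarrow> f s"
  proof (rule tendstoI)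
    fix \<epsilon> :: real assume \<epsilon>: "0 < \<epsilon>"
    have "isCont f s" using f s by (simp add: continuous_on_eq_continuous_at)
    then obtain \<delta> where \<delta>: "0 < \<delta>" "\<And>x. dist x s < \<delta> \<Longrightarrow> dist (f x) (f s) < \<epsilon> / 2"
      using \<epsilon> unfolding continuous_at_eps_delta by (metis half_gt_zero)
    have "\<forall>\<^sub>F k in sequentially. 0 < k \<and> 1 / real k < min \<delta> (T - s)"
      using small[of "min \<delta> (T - s)"] \<delta> s by simp
    then show "\<forall>\<^sub>F k in sequentially. dist (LINT x:{0<..<T}|lborel. g k x *\<^sub>R f x) (f s) < \<epsilon>"
    proof eventually_elim
      case (elim k)
      define J where "J = {s..s + 1 / real k}"
      have "((\<lambda>x. g k x) has_integral H (real k * (s + 1 / real k - s)) - H (real k * (s - s))) J"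
        unfolding J_def
      proof (rule fundamental_theorem_of_calculus)
        fix x
        show "((\<lambda>x. H (real k * (x - s))) has_vector_derivative g k x) (at x within {s..s + 1 / real k})"
        proof -
          have "((\<lambda>x. real k * (x - s)) has_real_derivative real k) (at x)"
            by (auto intro!: derivative_eq_intros)
          from has_field_derivative_at_within[OF DERIV_chain2[OF h(2) this]] show ?thesis
            by (simp add: has_real_derivative_iff_has_vector_derivative[symmetric] g_def mult.commute)
        qed
      qed (use elim in auto)
      then have I: "(g k has_integral 1) J" using elim h(4,5) by simp
      have cf: "continuous_on J f" using int(2)[of k] elim by (simp add: J_def)
      have "norm (integral J (\<lambda>x. g k x *\<^sub>R (f x - f s))) \<le> integral J (\<lambda>x. g k x * (\<epsilon> / 2))"
      proof (rule integral_norm_bound_integral)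
        show "(\<lambda>x. g k x *\<^sub>R (f x - f s)) integrable_on J"
          using cf unfolding J_def by (intro integrable_continuous_real continuous_intros cg)
        show "(\<lambda>x. g k x * (\<epsilon> / 2)) integrable_on J"
          unfolding J_def by (intro integrable_continuous_real continuous_intros cg)
        fix x assume x: "x \<in> J"
        have "dist (f x) (f s) < \<epsilon> / 2"
          using x elim by (intro \<delta>) (auto simp: J_def dist_real_def)
        then have "g k x * norm (f x - f s) \<le> g k x * (\<epsilon> / 2)"
          by (intro mult_left_mono) (auto simp: g_def h(3) dist_norm)
        then show "norm (g k x *\<^sub>R (f x - f s)) \<le> g k x * (\<epsilon> / 2)"
          by (simp add: g_def h(3))
      qed
      also have "integral J (\<lambda>x. g k x * (\<epsilon> / 2)) = \<epsilon> / 2"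
        using I by (simp add: integral_unique)
      also have "integral J (\<lambda>x. g k x *\<^sub>R (f x - f s)) = integral J (\<lambda>x. g k x *\<^sub>R f x) - f s"
      proof -
        have "(\<lambda>x. g k x *\<^sub>R f x) integrable_on J"
          using cf unfolding J_def by (intro integrable_continuous_real continuous_intros cg)
        from has_integral_diff[OF integrable_integral[OF this] has_integral_scaleR_left[OF I, of "f s"]]
        show ?thesis by (simp add: integral_unique scaleR_diff_right)
      qed
      finally show ?case
        using \<epsilon> int(3)[of k] elim by (simp add: dist_norm J_def)
    qed
  qed
  then show "(\<lambda>k. LINT x:{0<..<T}|lborel. (real k * h (real k * (x - s))) *\<^sub>R f x) \<longlonglongrightarrow> f s"
    by (simp add: g_def)
qed

text \<open>The test functions \<open>\<zeta> k\<close> tend boundedly to the indicator of (s, t],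
  which by dominated convergence gives the integral of \<open>w\<close>. Their derivatives are
  differences of approximate point masses at \<open>s\<close> and \<open>t\<close>, which give
  \<open>f s - f t\<close> on the other side of the weak formulation.\<close>

lemma weak_derivative_set_integral:
  fixes f :: "real \<Rightarrow> 'a::euclidean_space"
  assumes w: "has_weak_derivative_on {0<..<T} f w" and wi: "set_integrable lborel {0<..<T} w"
    and f: "continuous_on {0<..<T} f" and st: "0 < s" "s \<le> t" "t < T"
  shows "(LINT x:{s<..t}|lborel. w x) = f t - f s"
proof -
  obtain H h :: "real \<Rightarrow> real" where H: "smooth_on UNIV H" "continuous_on UNIV h"
    "\<And>x. (H has_real_derivative h x) (at x)" "\<And>x. 0 \<le> h x"
    "\<And>x. x \<le> 0 \<Longrightarrow> H x = 0" "\<And>x. 1 \<le> x \<Longrightarrow> H x = 1"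
    "\<And>x. x \<notin> {0<..<1} \<Longrightarrow> h x = 0" using smooth_step by blast
  have mono: "H x \<le> H y" if "x \<le> y" for x y
    using DERIV_nonneg_imp_nondecreasing[OF that, of H] H(3,4) by blast
  have H01: "0 \<le> H x" "H x \<le> 1" for x
    using mono[of "min x 0" x] mono[of x "max x 1"] H(5)[of "min x 0"] H(6)[of "max x 1"] by auto
  define \<zeta> where "\<zeta> k x = H (real k * (x - s)) - H (real k * (x - t))" for k :: nat and x
  have abs\<zeta>: "\<bar>\<zeta> k x\<bar> \<le> 1" for k x
    using H01[of "real k * (x - s)"] H01[of "real k * (x - t)"] by (auto simp: \<zeta>_def)
  have \<zeta>': "deriv (\<zeta> k) x = real k * h (real k * (x - s)) - real k * h (real k * (x - t))" for k x
    unfolding \<zeta>_def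
    by (rule DERIV_imp_deriv) (rule derivative_eq_intros DERIV_chain2[OF H(3)] refl | simp)+
  have c\<zeta>: "continuous_on A (\<zeta> k)" for A k
    unfolding \<zeta>_def by (intro smooth_on_UNIV_continuous smooth_on_diff_affine H(1))
  \<comment> \<open>The support of \<open>\<zeta> k\<close> reaches up to \<open>t + 1 / k\<close>,
    which must remain below \<open>T\<close>.\<close>
  have ev: "\<forall>\<^sub>F k in sequentially. 1 / real k < T - t" using st by real_asymp
  have test: "test_function {0<..<T} (\<zeta> k)" if k: "0 < k" "1 / real k < T - t" for k
  proof -
    have zero: "\<zeta> k x = 0" if "x \<notin> {s..t + 1 / real k}" for x
    proof (cases "x < s")
      case True
      then have "real k * (x - s) \<le> 0" "real k * (x - t) \<le> 0"
        using st by (auto simp: mult_le_0_iff)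
      then show ?thesis by (simp add: \<zeta>_def H(5))
    next
      case False
      then have "1 / real k < x - t" using that by auto
      then have 1: "1 \<le> real k * (x - t)" using k by (simp add: field_simps)
      also have "\<dots> \<le> real k * (x - s)" using st by (intro mult_left_mono) auto
      finally show ?thesis using 1 by (simp add: \<zeta>_def H(6))
    qed
    have "{x. \<zeta> k x \<noteq> 0} \<subseteq> {s..t + 1 / real k}"
    proof
      fix x assume "x \<in> {x. \<zeta> k x \<noteq> 0}"
      then show "x \<in> {s..t + 1 / real k}" using zero[of x] by (cases "x \<in> {s..t + 1 / real k}") simp_all
    qed
    then have cl: "closure {x. \<zeta> k x \<noteq> 0} \<subseteq> {s..t + 1 / real k}"
      by (rule closure_minimal) simp
    have "compact (closure {x. \<zeta> k x \<noteq> 0})"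
      using compact_Int_closed[OF compact_Icc closed_closure] cl by (metis inf.absorb2)
    moreover have "{s..t + 1 / real k} \<subseteq> {0<..<T}" using k st by auto
    then have "closure {x. \<zeta> k x \<noteq> 0} \<subseteq> {0<..<T}" using cl by (rule subset_trans[rotated])
    moreover have "smooth_on UNIV (\<zeta> k)"
      unfolding \<zeta>_def by (intro smooth_on_diff_affine H(1))
    ultimately show ?thesis
      unfolding test_function_def by blast
  qed
  \<comment> \<open>Since \<open>H 0 = 0\<close>, the limit is 0 at \<open>x = s\<close>; for
    \<open>s < t\<close> it is 1 at \<open>x = t\<close>. This is why the interval is open on the
    left and closed on the right.\<close>
  have lim\<zeta>: "(\<lambda>k. \<zeta> k x) \<longlonglongrightarrow> indicator {s<..t} x" for x
  proof -
    have *: "(\<lambda>k. H (real k * y)) \<longlonglongrightarrow> (if y > 0 then 1 else 0)" for y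
    proof (cases "y > 0")
      case True
      then have "\<forall>\<^sub>F k in sequentially. 1 \<le> real k * y" by real_asymp
      then show ?thesis using True by (intro tendsto_eventually) (auto elim!: eventually_mono simp: H(6))
    next
      case False
      then have "H (real k * y) = 0" for k by (intro H(5)) (simp add: mult_le_0_iff)
      then show ?thesis using False by simp
    qed
    from tendsto_diff[OF *[of "x - s"] *[of "x - t"]]
    show ?thesis using st by (auto simp: \<zeta>_def indicator_def split: if_splits)
  qed
  have "(\<lambda>k. LINT x:{0<..<T}|lborel. \<zeta> k x *\<^sub>R w x) \<longlonglongrightarrow> (LINT x:{0<..<T}|lborel. indicat_real {s<..t} x *\<^sub>R w x)"
    unfolding set_lebesgue_integral_def
  proof (rule integral_dominated_convergence)
    have wm: "(\<lambda>x. indicator {0<..<T} x *\<^sub>R w x) \<in> borel_measurable lborel"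
      using wi unfolding set_integrable_def by auto
    have e: "indicator {0<..<T} x *\<^sub>R (c *\<^sub>R w x) = c *\<^sub>R (indicator {0<..<T} x *\<^sub>R w x)" for c x by simp
    show "(\<lambda>x. indicator {0<..<T} x *\<^sub>R (indicat_real {s<..t} x *\<^sub>R w x)) \<in> borel_measurable lborel"
      unfolding e using wm by measurable
    have "\<zeta> k \<in> borel_measurable lborel" for k
      using borel_measurable_continuous_onI[OF c\<zeta>, of k] by simp
    then show "(\<lambda>x. indicator {0<..<T} x *\<^sub>R (\<zeta> k x *\<^sub>R w x)) \<in> borel_measurable lborel" for k
      unfolding e using wm by measurable
    show "integrable lborel (\<lambda>x. norm (indicator {0<..<T} x *\<^sub>R w x))"
      using wi unfolding set_integrable_def by (rule integrable_norm)
    show "AE x in lborel. (\<lambda>k. indicator {0<..<T} x *\<^sub>R (\<zeta> k x *\<^sub>R w x))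
        \<longlonglongrightarrow> indicator {0<..<T} x *\<^sub>R (indicat_real {s<..t} x *\<^sub>R w x)"
      by (intro AE_I2 tendsto_intros lim\<zeta>)
    show "AE x in lborel. norm (indicator {0<..<T} x *\<^sub>R (\<zeta> k x *\<^sub>R w x)) \<le> norm (indicator {0<..<T} x *\<^sub>R w x)" for k
      using abs\<zeta> by (intro AE_I2) (auto simp: indicator_def intro: mult_left_le_one_le)
  qed
  moreover have "(LINT x:{0<..<T}|lborel. indicat_real {s<..t} x *\<^sub>R w x) = (LINT x:{s<..t}|lborel. w x)"
    unfolding set_lebesgue_integral_def
    by (rule Bochner_Integration.integral_cong) (use st in \<open>auto simp: indicator_def\<close>)
  ultimately have R: "(\<lambda>k. LINT x:{0<..<T}|lborel. \<zeta> k x *\<^sub>R w x) \<longlonglongrightarrow> (LINT x:{s<..t}|lborel. w x)"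
    by simp
  have "s < T" "0 < t" using st by auto
  note m = mollified_at_point[OF H(2-4) H(5)[of 0] H(6)[of 1] H(7) f, simplified]
  note ms = m[OF st(1) \<open>s < T\<close>] and mt = m[OF \<open>0 < t\<close> st(3)]
  have "\<forall>\<^sub>F k in sequentially. (LINT x:{0<..<T}|lborel. (real k * h (real k * (x - s))) *\<^sub>R f x)
      - (LINT x:{0<..<T}|lborel. (real k * h (real k * (x - t))) *\<^sub>R f x)
      = - (LINT x:{0<..<T}|lborel. \<zeta> k x *\<^sub>R w x)"
    using ms(1) mt(1) ev eventually_gt_at_top[of 0]
  proof eventually_elim
    case (elim k)
    have "(LINT x:{0<..<T}|lborel. deriv (\<zeta> k) x *\<^sub>R f x) = - (LINT x:{0<..<T}|lborel. \<zeta> k x *\<^sub>R w x)"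
      using w test elim unfolding has_weak_derivative_on_def by blast
    then show ?case
      unfolding \<zeta>' scaleR_diff_left by (simp add: set_integral_diff(2)[OF elim(1,2)])
  qed
  with tendsto_diff[OF ms(2) mt(2)]
  have "(\<lambda>k. - (LINT x:{0<..<T}|lborel. \<zeta> k x *\<^sub>R w x)) \<longlonglongrightarrow> f s - f t"
    by (rule Lim_transform_eventually)
  from LIMSEQ_unique[OF this tendsto_minus[OF R]] show ?thesis by (simp add: algebra_simps)
qed

text \<open>The left endpoint 0 is gained here, where no test function reaches: both sides depend
  continuously on the lower limit, and they agree for positive ones. The ramp starting at time 0
  relies on it.\<close>

lemma weak_derivative_has_integral:
  fixes f :: "real \<Rightarrow> 'a::euclidean_space"
  assumes w: "has_weak_derivative_on {0<..<T} f w" and wi: "set_integrable lborel {0<..<T} w"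
    and f: "continuous_on {0..} f" and st: "0 \<le> s" "s \<le> t" "t < T"
  shows "(w has_integral (f t - f s)) {s..t}"
proof -
  have wint: "w integrable_on {a..b}" if "0 \<le> a" "b < T" for a b
  proof -
    have "w integrable_on {0<..<T}" using set_borel_integral_eq_integral(1)[OF wi] .
    then have "w integrable_on {0..T}"
      using integrable_on_Icc_iff_Ioo by blast
    then show ?thesis
      by (rule integrable_on_subinterval) (use that in auto)
  qed
  have pos: "integral {a..t} w = f t - f a" if a: "0 < a" "a \<le> t" for a
  proof -
    have "set_integrable lborel {a<..t} w"
      by (rule set_integrable_subset[OF wi]) (use a st in auto)
    moreover have "(LINT x:{a<..t}|lborel. w x) = f t - f a"
      by (rule weak_derivative_set_integral[OF w wi continuous_on_subset[OF f]]) (use a st in auto)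
    ultimately have "(w has_integral f t - f a) {a<..t}"
      using set_borel_integral_eq_integral by (metis integrable_integral)
    then have "(w has_integral f t - f a) {a..t}"
      by (rule has_integral_spike_set_eq[THEN iffD1, rotated 2])
        (auto intro: negligible_subset[of "{a}"])
    then show ?thesis by (rule integral_unique)
  qed
  have "integral {s..t} w = f t - f s"
  proof (cases "s = 0 \<and> 0 < t")
    case True
    have c1: "continuous_on {0..t} (\<lambda>a. integral {a..t} w)"
      by (rule indefinite_integral_continuous_1'[OF wint]) (use st in auto)
    have c2: "continuous_on {0..t} (\<lambda>a. f t - f a)"
      by (intro continuous_intros continuous_on_subset[OF f]) auto
    have "0 \<in> closure {0<..t}" using True by (simp add: closure_greaterThanAtMost)
    moreover have "continuous_on (closure {0<..t}) (\<lambda>a. integral {a..t} w - (f t - f a))"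
      using True c1 c2 by (simp add: continuous_on_diff)
    moreover have "integral {a..t} w - (f t - f a) = 0" if "a \<in> {0<..t}" for a
      using pos[of a] that by simp
    ultimately have "integral {0..t} w - (f t - f 0) = 0"
      by - (rule continuous_constant_on_closure)
    then show ?thesis using True by simp
  next
    case False
    then show ?thesis using pos[of s] st by (cases "s = t") auto
  qed
  then show ?thesis using integrable_integral[OF wint[of s t]] st by simp
qed

text \<open>By Lebesgue differentiation almost every value of \<open>d\<close> is a limit of
  averages over short intervals to its right, and these averages vanish. Extension by zero to
  \<open>e\<close> gives integrability on every interval, as the differentiation theorem
  asks.\<close>

lemma AE_zero_if_integrals_zero:
  fixes d :: "real \<Rightarrow> 'a::euclidean_space"
  assumes d: "set_integrable lborel {0<..<T} d"
    and zero: "\<And>s t. 0 < s \<Longrightarrow> s \<le> t \<Longrightarrow> t < T \<Longrightarrow> (d has_integral 0) {s..t}"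
  shows "AE x in lborel. x \<in> {0<..<T} \<longrightarrow> d x = 0"
proof -
  define e where "e x = indicator {0<..<T} x *\<^sub>R d x" for x
  have "e = (\<lambda>x. indicator {0<..<T} x *\<^sub>R d x)" by (auto simp: e_def)
  then have ie: "integrable lborel e" using d by (simp add: set_integrable_def)
  have "e integrable_on UNIV" using integrable_on_lborel[OF ie] .
  then have "e integrable_on cbox a b" for a b by (rule integrable_on_subcbox) auto
  then obtain N where N: "negligible N" "\<And>x \<epsilon>. x \<notin> N \<Longrightarrow> 0 < \<epsilon> \<Longrightarrow>
      \<exists>\<delta>>0. \<forall>h. 0 < h \<and> h < \<delta> \<longrightarrow> norm (integral (cbox x (x + h *\<^sub>R One)) e /\<^sub>R h ^ DIM(real) - e x) < \<epsilon>"
    by (rule integrable_ccontinuous_explicit) (rule that)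
  have e0: "e x = 0" if x: "x \<notin> N" "x \<in> {0<..<T}" for x
  proof (rule ccontr)
    assume "e x \<noteq> 0"
    then obtain \<delta> where \<delta>: "\<delta> > 0" "\<And>h. 0 < h \<and> h < \<delta> \<Longrightarrow>
        norm (integral {x..x + h} e /\<^sub>R h - e x) < norm (e x)"
      using N(2)[OF x(1), of "norm (e x)"] by (simp add: cbox_interval) blast
    define h where "h = min (\<delta> / 2) ((T - x) / 2)"
    have h: "0 < h" "h < \<delta>" "x + h < T" using \<delta> x by (auto simp: h_def min_def field_simps)
    have "(e has_integral 0) {x..x + h}"
      by (rule has_integral_eq[OF _ zero]) (use h x in \<open>auto simp: e_def\<close>)
    then show False using \<delta>(2)[of h] h by (simp add: integral_unique)
  qed
  \<comment> \<open>The exceptional set is null in the Lebesgue sense, so the statement is made for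
    the completed measure and then transferred to \<open>lborel\<close>.\<close>
  have "AE x in lebesgue. x \<notin> N"
    using N(1) by (simp add: negligible_iff_null_sets AE_not_in)
  then have "AE x in lebesgue. e x = 0"
    by eventually_elim (use e0 in \<open>auto simp: e_def indicator_def\<close>)
  then have "AE x in lborel. e x = 0"
    by (simp add: AE_completion_iff)
  then show ?thesis by eventually_elim (auto simp: e_def indicator_def)
qed

lemma weak_derivative_unique:
  fixes f :: "real \<Rightarrow> 'a::euclidean_space"
  assumes "has_weak_derivative_on {0<..<T} f v" "set_integrable lborel {0<..<T} v"
    and "has_weak_derivative_on {0<..<T} g w" "set_integrable lborel {0<..<T} w"
    and "continuous_on {0..} f" "continuous_on {0..} g" "\<And>t. 0 \<le> t \<Longrightarrow> f t = g t + c"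
  shows "AE x in lborel. x \<in> {0<..<T} \<longrightarrow> v x = w x"
proof -
  have "((\<lambda>x. v x - w x) has_integral 0) {s..t}" if "0 < s" "s \<le> t" "t < T" for s t
    using has_integral_diff[OF weak_derivative_has_integral[OF assms(1,2,5), of s t]
        weak_derivative_has_integral[OF assms(3,4,6), of s t]] that assms(7) by simp
  then have "AE x in lborel. x \<in> {0<..<T} \<longrightarrow> v x - w x = 0"
    by (intro AE_zero_if_integrals_zero set_integral_diff assms)
  then show ?thesis by simp
qed

text \<open>The norm is dominated by \<open>1 + (norm (w x))\<^sup>2\<close>, and 1 is integrable on
  an interval of finite length.\<close>

lemma square_integrable_imp_integrable:
  assumes "square_integrable_on {0<..<T} w"
  shows "set_integrable lborel {0<..<T} w"
proof -
  have 1: "set_integrable lborel {0<..<T} (\<lambda>x. 1 :: real)"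
    using borel_integrable_atLeastAtMost'[of 0 T "\<lambda>x. 1::real"]
    by (rule set_integrable_subset) auto
  have "set_integrable lborel {0<..<T} (\<lambda>x. 1 + (norm (w x))\<^sup>2)"
    using 1 assms by (intro set_integral_add) (auto simp: square_integrable_on_def)
  then show ?thesis
    unfolding set_integrable_def
  proof (rule Bochner_Integration.integrable_bound)
    show "(\<lambda>x. indicator {0<..<T} x *\<^sub>R w x) \<in> borel_measurable lborel"
      using assms by (simp add: square_integrable_on_def set_borel_measurable_def)
    have "a \<le> 1 + a\<^sup>2" for a :: real
      using zero_le_power2[of "a - 1/2"] by (simp add: power2_eq_square algebra_simps)
    then show "AE x in lborel. norm (indicator {0<..<T} x *\<^sub>R w x)
        \<le> norm (indicator {0<..<T} x *\<^sub>R (1 + (norm (w x))\<^sup>2))"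
      by (intro AE_I2) (auto simp: indicator_def)
  qed
qed

lemma test_function_props:
  assumes "test_function S \<zeta>"
  shows "continuous_on A \<zeta>" "continuous_on A (deriv \<zeta>)"
    "(\<zeta> has_real_derivative deriv \<zeta> t) (at t)"
    "t \<notin> closure {t. \<zeta> t \<noteq> 0} \<Longrightarrow> \<zeta> t = 0" "t \<notin> closure {t. \<zeta> t \<noteq> 0} \<Longrightarrow> deriv \<zeta> t = 0"
proof -
  obtain D where D: "\<And>t. D 0 t = \<zeta> t" "\<And>k t. (D k has_real_derivative D (Suc k) t) (at t)"
    using assms unfolding test_function_def smooth_on_def has_real_derivative_iff_has_vector_derivative
    by auto
  have D0: "D 0 = \<zeta>" using D(1) by auto
  have \<zeta>': "(\<zeta> has_real_derivative D 1 t) (at t)" for t using D(2)[of 0] D0 by simp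
  then have d: "deriv \<zeta> = D 1" by (auto intro: DERIV_imp_deriv)
  show "(\<zeta> has_real_derivative deriv \<zeta> t) (at t)" using \<zeta>' by (simp add: d)
  show "continuous_on A \<zeta>" using \<zeta>' by (meson DERIV_continuous continuous_at_imp_continuous_on)
  show "continuous_on A (deriv \<zeta>)"
    unfolding d using D(2) by (meson DERIV_continuous continuous_at_imp_continuous_on)
  have out: "\<zeta> t = 0" if "t \<notin> closure {t. \<zeta> t \<noteq> 0}" for t
    using that closure_subset[of "{t. \<zeta> t \<noteq> 0}"] by (auto simp: subset_iff)
  then show "t \<notin> closure {t. \<zeta> t \<noteq> 0} \<Longrightarrow> \<zeta> t = 0" .
  assume t: "t \<notin> closure {t. \<zeta> t \<noteq> 0}"
  have "((\<lambda>t. 0) has_real_derivative 0) (at t)" by simp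
  then have "(\<zeta> has_real_derivative 0) (at t)"
  proof (rule has_field_derivative_transform_within_open)
    show "open (- closure {t. \<zeta> t \<noteq> 0})" by (rule open_Compl) (rule closed_closure)
    show "t \<in> - closure {t. \<zeta> t \<noteq> 0}" using t by simp
    fix u assume "u \<in> - closure {t. \<zeta> t \<noteq> 0}"
    then show "0 = \<zeta> u" by (rule out[OF ComplD, symmetric])
  qed
  then show "deriv \<zeta> t = 0" by (rule DERIV_imp_deriv)
qed

text \<open>The factor \<open>c\<close> is bounded on \<open>K\<close> and vanishes off it, so only
  integrability of \<open>f\<close> on \<open>K\<close> matters. It is applied with \<open>c\<close>
  a test function or the derivative of one.\<close>

lemma locally_integrable_on_scaleR_compact_support:
  fixes f :: "real \<Rightarrow> 'a::euclidean_space"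
  assumes f: "locally_integrable_on S f" and K: "compact K" "K \<subseteq> S"
    and c: "continuous_on UNIV c" "\<And>t. t \<notin> K \<Longrightarrow> c t = (0::real)"
  shows "set_integrable lborel S (\<lambda>t. c t *\<^sub>R f t)"
proof -
  have eq: "indicator S t *\<^sub>R (c t *\<^sub>R f t) = c t *\<^sub>R (indicator K t *\<^sub>R f t)" for t
    using K(2) c(2)[of t] by (auto simp: indicator_def)
  have fK: "integrable lborel (\<lambda>t. indicator K t *\<^sub>R f t)"
    using f K unfolding locally_integrable_on_def set_integrable_def by blast
  have "compact (c ` K)" using K(1) c(1) by (meson compact_continuous_image continuous_on_subset subset_UNIV)
  then obtain B where B: "\<And>t. t \<in> K \<Longrightarrow> norm (c t) \<le> B"
    by (meson compact_imp_bounded bounded_iff image_eqI)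
  show ?thesis
    unfolding set_integrable_def eq
  proof (rule Bochner_Integration.integrable_bound)
    show "integrable lborel (\<lambda>t. B *\<^sub>R (indicator K t *\<^sub>R f t))" using fK by (rule integrable_scaleR_right)
    have "c \<in> borel_measurable lborel" using borel_measurable_continuous_onI[OF c(1)] by simp
    then show "(\<lambda>t. c t *\<^sub>R (indicator K t *\<^sub>R f t)) \<in> borel_measurable lborel"
      using fK by measurable
    show "AE t in lborel. norm (c t *\<^sub>R (indicator K t *\<^sub>R f t)) \<le> norm (B *\<^sub>R (indicator K t *\<^sub>R f t))"
    proof (rule AE_I2)
      fix t
      show "norm (c t *\<^sub>R (indicator K t *\<^sub>R f t)) \<le> norm (B *\<^sub>R (indicator K t *\<^sub>R f t))"
      proof (cases "t \<in> K")
        case True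
        then have "\<bar>c t\<bar> * norm (f t) \<le> \<bar>B\<bar> * norm (f t)"
          using B[OF True] by (intro mult_right_mono) auto
        then show ?thesis using True by simp
      qed simp
    qed
  qed
qed

lemma test_function_integrable:
  fixes f :: "real \<Rightarrow> 'a::euclidean_space"
  assumes \<zeta>: "test_function S \<zeta>" and f: "locally_integrable_on S f"
  shows "set_integrable lborel S (\<lambda>t. \<zeta> t *\<^sub>R f t)" "set_integrable lborel S (\<lambda>t. deriv \<zeta> t *\<^sub>R f t)"
proof -
  have K: "compact (closure {t. \<zeta> t \<noteq> 0})" "closure {t. \<zeta> t \<noteq> 0} \<subseteq> S"
    using \<zeta> unfolding test_function_def by auto
  show "set_integrable lborel S (\<lambda>t. \<zeta> t *\<^sub>R f t)" "set_integrable lborel S (\<lambda>t. deriv \<zeta> t *\<^sub>R f t)"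
    by (rule locally_integrable_on_scaleR_compact_support[OF f K];
        rule test_function_props[OF \<zeta>]; assumption)+
qed

lemma has_weak_derivative_on_add_scaleR:
  fixes f g :: "real \<Rightarrow> 'a::euclidean_space"
  assumes f: "has_weak_derivative_on S f f'" and g: "has_weak_derivative_on S g g'"
  shows "has_weak_derivative_on S (\<lambda>t. f t + c *\<^sub>R g t) (\<lambda>t. f' t + c *\<^sub>R g' t)"
proof -
  have loc: "locally_integrable_on S (\<lambda>t. u t + c *\<^sub>R v t)"
    if "locally_integrable_on S u" "locally_integrable_on S v" for u v :: "real \<Rightarrow> 'a"
    using that unfolding locally_integrable_on_def
    by (auto intro!: set_integral_add set_integrable_scaleR_right)
  have lin: "(LINT t:S|lborel. z t *\<^sub>R (u t + c *\<^sub>R v t))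
      = (LINT t:S|lborel. z t *\<^sub>R u t) + c *\<^sub>R (LINT t:S|lborel. z t *\<^sub>R v t)"
    if "set_integrable lborel S (\<lambda>t. z t *\<^sub>R u t)" "set_integrable lborel S (\<lambda>t. z t *\<^sub>R v t)"
    for z :: "real \<Rightarrow> real" and u v :: "real \<Rightarrow> 'a"
  proof -
    have e: "z t *\<^sub>R (u t + c *\<^sub>R v t) = z t *\<^sub>R u t + c *\<^sub>R (z t *\<^sub>R v t)" for t
      by (simp add: scaleR_add_right)
    have "set_integrable lborel S (\<lambda>t. c *\<^sub>R (z t *\<^sub>R v t))"
      using that(2) by (intro set_integrable_scaleR_right) auto
    from set_integral_add(2)[OF that(1) this] show ?thesis
      unfolding e set_integral_scaleR_right .
  qed
  show ?thesis
    unfolding has_weak_derivative_on_def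
  proof (intro conjI allI impI)
    have L: "locally_integrable_on S f" "locally_integrable_on S f'"
      "locally_integrable_on S g" "locally_integrable_on S g'"
      using f g unfolding has_weak_derivative_on_def by auto
    then show "locally_integrable_on S (\<lambda>t. f t + c *\<^sub>R g t)" "locally_integrable_on S (\<lambda>t. f' t + c *\<^sub>R g' t)"
      by (auto intro!: loc)
    fix \<eta> assume \<eta>: "test_function S \<eta>"
    then show "(LINT t:S|lborel. deriv \<eta> t *\<^sub>R (f t + c *\<^sub>R g t))
        = - (LINT t:S|lborel. \<eta> t *\<^sub>R (f' t + c *\<^sub>R g' t))"
      unfolding lin[OF test_function_integrable(2)[OF \<eta> L(1)] test_function_integrable(2)[OF \<eta> L(3)]]
        lin[OF test_function_integrable(1)[OF \<eta> L(2)] test_function_integrable(1)[OF \<eta> L(4)]]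
      using f g unfolding has_weak_derivative_on_def by simp
  qed
qed

section \<open>Piecewise linear perturbations\<close>

text \<open>For nonnegative \<open>h\<close> this is the primitive of the indicator of (s, s + h):
  zero up to \<open>s\<close>, then of slope one, finally constant with value
  \<open>h\<close>.\<close>

definition ramp :: "real \<Rightarrow> real \<Rightarrow> real \<Rightarrow> real" where
  "ramp s h t = min h (max 0 (t - s))"

lemma continuous_on_ramp [continuous_intros]: "continuous_on A (ramp s h)"
  unfolding ramp_def by (intro continuous_intros)

text \<open>The fundamental theorem of calculus applies with the two corners as exceptional points.
  Vector values are allowed because the identity serves twice: with a scalar test function, for the
  weak derivative of a ramp, and with the antiderivative of the force along the minimizer.\<close>

lemma ramp_by_parts:
  fixes \<zeta> :: "real \<Rightarrow> 'a::euclidean_space"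
  assumes "0 \<le> h" "0 \<le> T"
    and \<zeta>: "\<And>x. x \<in> {0..T} \<Longrightarrow> (\<zeta> has_vector_derivative \<zeta>' x) (at x within {0..T})"
  shows "((\<lambda>t. ramp s h t *\<^sub>R \<zeta>' t + indicator {s<..<s + h} t *\<^sub>R \<zeta> t) has_integral
    ramp s h T *\<^sub>R \<zeta> T - ramp s h 0 *\<^sub>R \<zeta> 0) {0..T}"
proof (rule fundamental_theorem_of_calculus_interior_strong[where S="{s, s + h}"])
  show "continuous_on {0..T} (\<lambda>t. ramp s h t *\<^sub>R \<zeta> t)"
    using has_vector_derivative_continuous[OF \<zeta>]
    by (intro continuous_intros) (simp add: continuous_on_eq_continuous_within)
  fix x assume x: "x \<in> {0<..<T} - {s, s + h}"
  then have \<zeta>x: "(\<zeta> has_vector_derivative \<zeta>' x) (at x)"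
    using \<zeta>[of x] by (simp add: at_within_Icc_at)
  consider "x < s" | "s < x" "x < s + h" | "s + h < x" using x by fastforce
  then have "(ramp s h has_real_derivative indicator {s<..<s + h} x) (at x)"
  proof cases
    case 1
    have "((\<lambda>t. 0) has_real_derivative indicator {s<..<s + h} x) (at x)"
      using 1 by simp
    then show ?thesis
      by (rule has_field_derivative_transform_within_open[where S="{..<s}"])
        (use 1 assms in \<open>auto simp: ramp_def\<close>)
  next
    case 2
    have "((\<lambda>t. t - s) has_real_derivative indicator {s<..<s + h} x) (at x)"
      using 2 by (auto intro!: derivative_eq_intros)
    then show ?thesis
      by (rule has_field_derivative_transform_within_open[where S="{s<..<s + h}"])
        (use 2 assms in \<open>auto simp: ramp_def\<close>)
  next
    case 3
    have "((\<lambda>t. h) has_real_derivative indicator {s<..<s + h} x) (at x)"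
      using 3 by simp
    then show ?thesis
      by (rule has_field_derivative_transform_within_open[where S="{s + h<..}"])
        (use 3 assms in \<open>auto simp: ramp_def\<close>)
  qed
  from has_vector_derivative_scaleR[OF this \<zeta>x]
  show "((\<lambda>t. ramp s h t *\<^sub>R \<zeta> t) has_vector_derivative
      ramp s h x *\<^sub>R \<zeta>' x + indicator {s<..<s + h} x *\<^sub>R \<zeta> x) (at x)" by simp
qed (use assms in auto)

lemma set_integrable_indicator_scaleR:
  fixes e :: "'a::euclidean_space" and A C :: "real set"
  assumes "C \<in> sets lborel" "emeasure lborel C < \<infinity>" "A \<in> sets lborel"
  shows "set_integrable lborel C (\<lambda>t. indicator A t *\<^sub>R e)"
proof -
  have "integrable lborel (indicator (A \<inter> C) :: real \<Rightarrow> real)"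
    using assms by (subst integrable_indicator_iff)
      (auto intro: le_less_trans[OF emeasure_mono[of "A \<inter> C" C]])
  then have "integrable lborel (\<lambda>t. indicator (A \<inter> C) t *\<^sub>R e)" by (rule integrable_scaleR_left)
  then show ?thesis
    unfolding set_integrable_def by (rule Bochner_Integration.integrable_cong[THEN iffD1, rotated 2])
      (auto simp: indicator_def)
qed

lemma has_weak_derivative_on_ramp:
  fixes e :: "'a::euclidean_space"
  assumes T: "0 < T" and h: "0 \<le> h"
  shows "has_weak_derivative_on {0<..<T} (\<lambda>t. ramp s h t *\<^sub>R e) (\<lambda>t. indicator {s<..<s + h} t *\<^sub>R e)"
proof -
  have 1: "locally_integrable_on {0<..<T} (\<lambda>t. ramp s h t *\<^sub>R e)"
    unfolding locally_integrable_on_def set_integrable_def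
    by (intro allI impI borel_integrable_compact continuous_intros) auto
  have 2: "locally_integrable_on {0<..<T} (\<lambda>t. indicator {s<..<s + h} t *\<^sub>R e)"
    unfolding locally_integrable_on_def
    by (intro allI impI set_integrable_indicator_scaleR) (auto intro!: emeasure_bounded_finite[simplified] compact_imp_bounded simp: borel_compact)
  have "(LINT t:{0<..<T}|lborel. deriv \<zeta> t *\<^sub>R ramp s h t *\<^sub>R e)
      = - (LINT t:{0<..<T}|lborel. \<zeta> t *\<^sub>R indicator {s<..<s + h} t *\<^sub>R e)"
    if \<zeta>: "test_function {0<..<T} \<zeta>" for \<zeta>
  proof -
    have z: "\<zeta> 0 = 0" "\<zeta> T = 0"
      by (rule test_function_props(4)[OF \<zeta>]; use \<zeta> in \<open>force simp: test_function_def\<close>)+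
    have "((\<lambda>t. ramp s h t *\<^sub>R deriv \<zeta> t + indicator {s<..<s + h} t *\<^sub>R \<zeta> t) has_integral
        ramp s h T *\<^sub>R \<zeta> T - ramp s h 0 *\<^sub>R \<zeta> 0) {0..T}"
      using T h by (intro ramp_by_parts)
        (auto simp: has_real_derivative_iff_has_vector_derivative[symmetric]
          intro: has_field_derivative_at_within test_function_props(3)[OF \<zeta>])
    from has_integral_scaleR_left[OF this, of e]
    have "((\<lambda>t. deriv \<zeta> t *\<^sub>R ramp s h t *\<^sub>R e + \<zeta> t *\<^sub>R indicator {s<..<s + h} t *\<^sub>R e) has_integral 0) {0<..<T}"
      by (simp add: z scaleR_add_left mult.commute has_integral_Icc_iff_Ioo)
    then have "integral {0<..<T} (\<lambda>t. deriv \<zeta> t *\<^sub>R ramp s h t *\<^sub>R e + \<zeta> t *\<^sub>R indicator {s<..<s + h} t *\<^sub>R e) = 0"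
      by (rule integral_unique)
    moreover note add = set_integral_add[OF test_function_integrable(2)[OF \<zeta> 1] test_function_integrable(1)[OF \<zeta> 2]]
    ultimately have "(LINT t:{0<..<T}|lborel. deriv \<zeta> t *\<^sub>R ramp s h t *\<^sub>R e)
        + (LINT t:{0<..<T}|lborel. \<zeta> t *\<^sub>R indicator {s<..<s + h} t *\<^sub>R e) = 0"
      unfolding add(2)[symmetric] by (subst set_borel_integral_eq_integral(2)[OF add(1)])
    then show ?thesis by (simp add: eq_neg_iff_add_eq_0)
  qed
  with 1 2 show ?thesis unfolding has_weak_derivative_on_def by blast
qed

subsection \<open>Lifts and weak velocities of torus curves\<close>

text \<open>Divided by \<open>2 * pi\<close>, each component of the difference is continuous and
  integer valued on a connected half-line; distinct integers are at least 1 apart, so it is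
  constant.\<close>

lemma is_lift_unique:
  assumes "is_lift \<Phi> \<phi>" "is_lift \<Phi> \<psi>"
  obtains c where "\<And>t. 0 \<le> t \<Longrightarrow> \<phi> t = \<psi> t + c"
proof -
  have "(\<lambda>t. (\<phi> t $ i - \<psi> t $ i) / (2 * pi)) constant_on {0..}" for i
  proof (rule continuous_discrete_range_constant)
    show "connected {0::real..}" by (simp add: convex_connected)
    show "continuous_on {0..} (\<lambda>t. (\<phi> t $ i - \<psi> t $ i) / (2 * pi))"
      using assms unfolding is_lift_def by (intro continuous_intros) auto
    fix t :: real assume t: "t \<in> {0..}"
    have int: "\<exists>k::int. (\<phi> t $ i - \<psi> t $ i) / (2 * pi) = of_int k" if "t \<in> {0..}" for t
    proof -
      have "torus_proj (\<phi> t) = torus_proj (\<psi> t)"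
        using assms that unfolding is_lift_def by simp
      then obtain k :: int where "\<phi> t $ i - \<psi> t $ i = 2 * pi * of_int k"
        unfolding torus_proj_eq_iff by blast
      then show ?thesis by auto
    qed
    show "\<exists>e>0. \<forall>u. u \<in> {0..} \<and> (\<phi> u $ i - \<psi> u $ i) / (2 * pi) \<noteq> (\<phi> t $ i - \<psi> t $ i) / (2 * pi) \<longrightarrow>
        e \<le> norm ((\<phi> u $ i - \<psi> u $ i) / (2 * pi) - (\<phi> t $ i - \<psi> t $ i) / (2 * pi))"
    proof (intro exI[of _ 1] conjI allI impI)
      fix u
      assume u: "u \<in> {0..} \<and> (\<phi> u $ i - \<psi> u $ i) / (2 * pi) \<noteq> (\<phi> t $ i - \<psi> t $ i) / (2 * pi)"
      obtain k l :: int where "(\<phi> u $ i - \<psi> u $ i) / (2 * pi) = of_int k"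
        "(\<phi> t $ i - \<psi> t $ i) / (2 * pi) = of_int l" using int u t by meson
      with u have kl: "(\<phi> u $ i - \<psi> u $ i) / (2 * pi) - (\<phi> t $ i - \<psi> t $ i) / (2 * pi) = of_int (k - l)" "k \<noteq> l"
        by auto
      then have "1 \<le> \<bar>k - l\<bar>" by simp
      then have "(1::real) \<le> \<bar>of_int (k - l)\<bar>" by linarith
      then show "1 \<le> norm ((\<phi> u $ i - \<psi> u $ i) / (2 * pi) - (\<phi> t $ i - \<psi> t $ i) / (2 * pi))"
        unfolding kl(1) by simp
    qed simp
  qed
  then have "\<exists>d. \<forall>t\<in>{0..}. (\<phi> t $ i - \<psi> t $ i) / (2 * pi) = d" for i
    unfolding constant_on_def .
  then obtain d where d: "\<And>i t. 0 \<le> t \<Longrightarrow> (\<phi> t $ i - \<psi> t $ i) / (2 * pi) = d i"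
    by (metis atLeast_iff)
  show thesis
  proof (rule that)
    fix t :: real assume "0 \<le> t"
    then show "\<phi> t = \<psi> t + (\<chi> i. 2 * pi * d i)"
      using d[of t] by (auto simp: vec_eq_iff field_simps)
  qed
qed

lemma AE_positive_if_AE_bounded:
  assumes "\<And>T. 0 < T \<Longrightarrow> AE t in lborel. t \<in> {0<..<T} \<longrightarrow> P t"
  shows "AE t in lborel. 0 < t \<longrightarrow> P (t::real)"
proof -
  have "AE t in lborel. \<forall>n::nat. t \<in> {0<..<real (Suc n)} \<longrightarrow> P t"
    unfolding AE_all_countable using assms[of "real (Suc _)"] by (simp del: of_nat_Suc)
  then show ?thesis
  proof eventually_elim
    case (elim t)
    obtain n where "t < real n" using reals_Archimedean2 by blast
    then have "0 < t \<Longrightarrow> t \<in> {0<..<real (Suc n)}" by simp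
    with elim show ?case by blast
  qed
qed

text \<open>As \<open>weak_velocity\<close> is a choice, nothing can be said of its values at single
  times. Its lift differs from \<open>\<psi>\<close> by a constant, and uniqueness of weak
  derivatives then identifies it up to a null set with any computed velocity
  \<open>u\<close>.\<close>

lemma weak_velocity_AE_eq:
  assumes \<psi>: "is_lift \<Psi> \<psi>"
    and u: "\<And>T. 0 < T \<Longrightarrow> has_weak_derivative_on {0<..<T} \<psi> u"
    and sq: "\<And>T. 0 < T \<Longrightarrow> square_integrable_on {0<..<T} u"
  shows "AE t in lborel. 0 < t \<longrightarrow> weak_velocity \<Psi> t = u t"
    "has_weak_velocity \<Psi> (weak_velocity \<Psi>)"
proof -
  have "has_weak_velocity \<Psi> u" using assms unfolding has_weak_velocity_def by blast
  then show *: "has_weak_velocity \<Psi> (weak_velocity \<Psi>)"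
    unfolding weak_velocity_def by (rule someI[where P="has_weak_velocity \<Psi>"])
  then obtain \<xi> where \<xi>: "is_lift \<Psi> \<xi>"
    "\<And>T. 0 < T \<Longrightarrow> has_weak_derivative_on {0<..<T} \<xi> (weak_velocity \<Psi>)"
    "\<And>T. 0 < T \<Longrightarrow> square_integrable_on {0<..<T} (weak_velocity \<Psi>)"
    unfolding has_weak_velocity_def by blast
  obtain c where c: "\<And>t. 0 \<le> t \<Longrightarrow> \<xi> t = \<psi> t + c"
    using is_lift_unique[OF \<xi>(1) \<psi>] by blast
  show "AE t in lborel. 0 < t \<longrightarrow> weak_velocity \<Psi> t = u t"
    by (intro AE_positive_if_AE_bounded weak_derivative_unique[OF \<xi>(2) _ u _ _ _ c]
        square_integrable_imp_integrable \<xi>(3) sq)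
      (use \<xi>(1) \<psi> in \<open>auto simp: is_lift_def\<close>)
qed

text \<open>Measurability is given on bounded intervals only; on the half-line the function is the
  pointwise limit of its truncations.\<close>

lemma has_weak_velocity_measurable:
  assumes "has_weak_velocity \<Psi> v"
  shows "set_borel_measurable lborel {0<..} v"
proof -
  have m: "(\<lambda>t. indicator {0<..<real (Suc n)} t *\<^sub>R v t) \<in> borel_measurable lborel" for n
    using assms unfolding has_weak_velocity_def square_integrable_on_def set_borel_measurable_def
    by (metis of_nat_0_less_iff zero_less_Suc)
  show ?thesis
    unfolding set_borel_measurable_def
  proof (rule borel_measurable_LIMSEQ_metric[OF m])
    fix t
    obtain N where N: "t < real N" using reals_Archimedean2 by blast
    have "\<forall>\<^sub>F n in sequentially. indicator {0<..<real (Suc n)} t *\<^sub>R v t = indicator {0<..} t *\<^sub>R v t"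
      using eventually_ge_at_top[of N] by eventually_elim (use N in \<open>auto simp: indicator_def\<close>)
    then show "(\<lambda>n. indicator {0<..<real (Suc n)} t *\<^sub>R v t) \<longlonglongrightarrow> indicator {0<..} t *\<^sub>R v t"
      by (rule tendsto_eventually)
  qed
qed

subsection \<open>The first variation\<close>

lemma real_analytic_continuous_on: "real_analytic f \<Longrightarrow> continuous_on A f"
  by (metis real_analytic_partials continuous_at_imp_continuous_on gderiv_def has_derivative_continuous)

text \<open>The lift \<open>\<phi>\<close> is one whose weak derivative is the very representative
  \<open>weak_velocity \<Phi>\<close> that occurs in the Lagrangian, so for the minimizer itself no
  change of representative intervenes.\<close>

locale torus_minimizer =
  fixes Q :: "'n::finite torus \<Rightarrow> real"
    and \<Phi>0 :: "'n torus"
    and \<Phi> :: "real \<Rightarrow> 'n torus"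
    and \<phi> :: "real \<Rightarrow> real ^ 'n"
    and G :: "real ^ 'n \<Rightarrow> real ^ 'n"
  assumes Q_nonneg: "\<And>p. 0 \<le> Q p"
    and \<Phi>_admissible: "\<Phi> \<in> admissible Q \<Phi>0"
    and \<Phi>_minimizer: "\<And>\<Psi>. \<Psi> \<in> admissible Q \<Phi>0 \<Longrightarrow> action Q \<Phi> \<le> action Q \<Psi>"
    and \<phi>_lift: "is_lift \<Phi> \<phi>"
    and \<phi>_weak: "\<And>T. 0 < T \<Longrightarrow> has_weak_derivative_on {0<..<T} \<phi> (weak_velocity \<Phi>)"
    and sq: "\<And>T. 0 < T \<Longrightarrow> square_integrable_on {0<..<T} (weak_velocity \<Phi>)"
    and G: "\<And>x. GDERIV (\<lambda>x. Q (torus_proj x)) x :> G x"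
    and G_analytic: "\<And>i. real_analytic (\<lambda>x. G x $ i)"
begin

abbreviation F :: "real ^ 'n \<Rightarrow> real" where "F x \<equiv> Q (torus_proj x)"
abbreviation w :: "real \<Rightarrow> real ^ 'n" where "w \<equiv> weak_velocity \<Phi>"

lemma F_continuous: "continuous_on A F"
  using G by (meson continuous_at_imp_continuous_on gderiv_def has_derivative_continuous)

lemma G_continuous: "continuous_on A G"
proof -
  have "continuous_on A (\<lambda>x. \<chi> i. G x $ i)"
    by (intro continuous_on_vec_lambda real_analytic_continuous_on G_analytic)
  then show ?thesis by simp
qed

lemma \<phi>_continuous: "continuous_on {0..} \<phi>"
  using \<phi>_lift by (simp add: is_lift_def)

lemma \<Phi>_eq: "0 \<le> t \<Longrightarrow> \<Phi> t = torus_proj (\<phi> t)"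
  using \<phi>_lift by (simp add: is_lift_def)

lemma w_integrable: "set_integrable lborel {0<..<T} w"
proof (cases "0 < T")
  case False
  then show ?thesis by (simp add: set_integrable_def)
qed (intro square_integrable_imp_integrable sq)

lemma w_has_integral: "0 \<le> s \<Longrightarrow> s \<le> t \<Longrightarrow> (w has_integral (\<phi> t - \<phi> s)) {s..t}"
  by (rule weak_derivative_has_integral[OF \<phi>_weak[of "t + 1"] w_integrable \<phi>_continuous]) auto

end

text \<open>Only a bounded measurable weak derivative is asked of \<open>\<eta>\<close>, so that
  ramps qualify. Vanishing at 0 keeps the initial point, and vanishing of both functions from
  \<open>M\<close> on confines the change of the action to (0, M).\<close>

locale torus_variation = torus_minimizer Q \<Phi>0 \<Phi> \<phi> G
  for Q :: "'n::finite torus \<Rightarrow> real" and \<Phi>0 \<Phi> \<phi> G +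
  fixes \<eta> \<eta>' :: "real \<Rightarrow> real ^ 'n" and M B :: real
  assumes M: "0 < M"
    and \<eta>_continuous: "continuous_on UNIV \<eta>"
    and \<eta>_0: "\<eta> 0 = 0"
    and \<eta>_M: "\<And>t. M \<le> t \<Longrightarrow> \<eta> t = 0" "\<And>t. M \<le> t \<Longrightarrow> \<eta>' t = 0"
    and \<eta>_weak: "\<And>T. 0 < T \<Longrightarrow> has_weak_derivative_on {0<..<T} \<eta> \<eta>'"
    and \<eta>'_measurable: "\<eta>' \<in> borel_measurable lborel"
    and \<eta>'_bound: "\<And>t. norm (\<eta>' t) \<le> B"
begin

lemma inner_integrable: "set_integrable lborel {0<..<T} (\<lambda>t. w t \<bullet> \<eta>' t)"
  unfolding set_integrable_def
proof (rule Bochner_Integration.integrable_bound)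
  show "integrable lborel (\<lambda>t. B * norm (indicator {0<..<T} t *\<^sub>R w t))"
    using w_integrable[of T] unfolding set_integrable_def
    by (intro integrable_mult_right integrable_norm)
  have e: "indicator {0<..<T} t *\<^sub>R (w t \<bullet> \<eta>' t) = (indicator {0<..<T} t *\<^sub>R w t) \<bullet> \<eta>' t" for t by simp
  have "(\<lambda>t. indicator {0<..<T} t *\<^sub>R w t) \<in> borel_measurable lborel"
    using w_integrable[of T] unfolding set_integrable_def by auto
  then show "(\<lambda>t. indicator {0<..<T} t *\<^sub>R (w t \<bullet> \<eta>' t)) \<in> borel_measurable lborel"
    unfolding e by (intro borel_measurable_inner \<eta>'_measurable)
  show "AE t in lborel. norm (indicator {0<..<T} t *\<^sub>R (w t \<bullet> \<eta>' t))
      \<le> norm (B * norm (indicator {0<..<T} t *\<^sub>R w t))"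
  proof (rule AE_I2)
    fix t
    have "\<bar>w t \<bullet> \<eta>' t\<bar> \<le> norm (w t) * norm (\<eta>' t)" by (rule Cauchy_Schwarz_ineq2)
    also have "\<dots> \<le> norm (w t) * \<bar>B\<bar>"
      using \<eta>'_bound[of t] by (intro mult_left_mono) auto
    finally show "norm (indicator {0<..<T} t *\<^sub>R (w t \<bullet> \<eta>' t))
        \<le> norm (B * norm (indicator {0<..<T} t *\<^sub>R w t))"
      by (auto simp: indicator_def abs_mult mult.commute)
  qed
qed

lemma \<eta>'_square_integrable: "set_integrable lborel {0<..<T} (\<lambda>t. (norm (\<eta>' t))\<^sup>2)"
  unfolding set_integrable_def
proof (rule Bochner_Integration.integrable_bound)
  show "integrable lborel (\<lambda>t. indicator {0<..<T} t *\<^sub>R B\<^sup>2)"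
    using integrable_real_indicator[of "{0<..<T}" lborel]
    by (cases "0 \<le> T") (auto simp: emeasure_lborel_Ioo)
  show "(\<lambda>t. indicator {0<..<T} t *\<^sub>R (norm (\<eta>' t))\<^sup>2) \<in> borel_measurable lborel"
    using \<eta>'_measurable by measurable
  show "AE t in lborel. norm (indicator {0<..<T} t *\<^sub>R (norm (\<eta>' t))\<^sup>2) \<le> norm (indicator {0<..<T} t *\<^sub>R B\<^sup>2)"
    using power_mono[OF \<eta>'_bound norm_ge_zero, of _ 2] by (intro AE_I2) (auto simp: indicator_def)
qed

definition \<psi> :: "real \<Rightarrow> real \<Rightarrow> real ^ 'n" where "\<psi> \<epsilon> t = \<phi> t + \<epsilon> *\<^sub>R \<eta> t"
definition \<Psi> :: "real \<Rightarrow> real \<Rightarrow> 'n torus" where "\<Psi> \<epsilon> t = torus_proj (\<psi> \<epsilon> t)"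

lemma \<psi>_continuous: "continuous_on {0..} (\<psi> \<epsilon>)"
  unfolding \<psi>_def by (intro continuous_intros \<phi>_continuous continuous_on_subset[OF \<eta>_continuous]) auto

lemma \<Psi>_lift: "is_lift (\<Psi> \<epsilon>) (\<psi> \<epsilon>)"
  using \<psi>_continuous by (simp add: is_lift_def \<Psi>_def)

lemma norm_sum_square:
  "(norm (w t + \<epsilon> *\<^sub>R \<eta>' t))\<^sup>2 = (norm (w t))\<^sup>2 + 2 * \<epsilon> * (w t \<bullet> \<eta>' t) + \<epsilon>\<^sup>2 * (norm (\<eta>' t))\<^sup>2"
  unfolding power2_norm_eq_inner
  by (simp add: inner_simps inner_commute algebra_simps power2_eq_square)

lemma \<Psi>_velocity_square_integrable:
  assumes "0 < T"
  shows "square_integrable_on {0<..<T} (\<lambda>t. w t + \<epsilon> *\<^sub>R \<eta>' t)"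
  unfolding square_integrable_on_def
proof
  have wm: "(\<lambda>t. indicator {0<..<T} t *\<^sub>R w t) \<in> borel_measurable lborel"
    using w_integrable[of T] unfolding set_integrable_def by auto
  show "set_borel_measurable lborel {0<..<T} (\<lambda>t. w t + \<epsilon> *\<^sub>R \<eta>' t)"
    unfolding set_borel_measurable_def scaleR_add_right
    using wm \<eta>'_measurable by measurable
  show "set_integrable lborel {0<..<T} (\<lambda>t. (norm (w t + \<epsilon> *\<^sub>R \<eta>' t))\<^sup>2)"
    unfolding norm_sum_square
    using sq[OF assms] inner_integrable \<eta>'_square_integrable
    by (intro set_integral_add set_integrable_mult_right) (auto simp: square_integrable_on_def)
qed

lemma \<Psi>_velocity:
  "AE t in lborel. 0 < t \<longrightarrow> weak_velocity (\<Psi> \<epsilon>) t = w t + \<epsilon> *\<^sub>R \<eta>' t"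
  "has_weak_velocity (\<Psi> \<epsilon>) (weak_velocity (\<Psi> \<epsilon>))"
proof -
  have wd: "has_weak_derivative_on {0<..<T} (\<psi> \<epsilon>) (\<lambda>t. w t + \<epsilon> *\<^sub>R \<eta>' t)" if "0 < T" for T
  proof -
    have "\<psi> \<epsilon> = (\<lambda>t. \<phi> t + \<epsilon> *\<^sub>R \<eta> t)" by (auto simp: \<psi>_def)
    then show ?thesis
      using has_weak_derivative_on_add_scaleR[OF \<phi>_weak[OF that] \<eta>_weak[OF that]] by simp
  qed
  show "AE t in lborel. 0 < t \<longrightarrow> weak_velocity (\<Psi> \<epsilon>) t = w t + \<epsilon> *\<^sub>R \<eta>' t"
    "has_weak_velocity (\<Psi> \<epsilon>) (weak_velocity (\<Psi> \<epsilon>))"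
    by (rule weak_velocity_AE_eq[OF \<Psi>_lift wd \<Psi>_velocity_square_integrable]; assumption)+
qed

definition \<Delta> :: "real \<Rightarrow> real \<Rightarrow> real" where
  "\<Delta> \<epsilon> t = \<epsilon> * (w t \<bullet> \<eta>' t) + \<epsilon>\<^sup>2 / 2 * (norm (\<eta>' t))\<^sup>2 + (F (\<psi> \<epsilon> t) - F (\<phi> t))"

text \<open>The square of the perturbed velocity is expanded before \<open>M\<close>, and from
  \<open>M\<close> on the two curves and their velocities coincide. Equality is almost everywhere
  because the weak velocity of the competitor is a chosen representative.\<close>

lemma lagrangian_\<Psi>:
  "AE t in lborel. 0 < t \<longrightarrow>
    lagrangian Q (\<Psi> \<epsilon>) t = lagrangian Q \<Phi> t + indicator {0<..<M} t *\<^sub>R \<Delta> \<epsilon> t"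
  using \<Psi>_velocity(1)[of \<epsilon>]
proof eventually_elim
  case (elim t)
  show ?case
  proof
    assume t: "0 < t"
    show "lagrangian Q (\<Psi> \<epsilon>) t = lagrangian Q \<Phi> t + indicator {0<..<M} t *\<^sub>R \<Delta> \<epsilon> t"
    proof (cases "t < M")
      case True
      then show ?thesis
        using t elim by (simp add: lagrangian_def norm_sum_square \<Delta>_def \<Psi>_def \<Phi>_eq algebra_simps)
    next
      case False
      then show ?thesis
        using t elim \<eta>_M[of t] by (simp add: lagrangian_def \<Psi>_def \<psi>_def \<Phi>_eq)
    qed
  qed
qed

lemma F_along_integrable:
  "set_integrable lborel {0<..<M} (\<lambda>t. F (\<psi> \<epsilon> t))" "set_integrable lborel {0<..<M} (\<lambda>t. F (\<phi> t))"
  "set_integrable lborel {0<..<M} (\<lambda>t. G (\<phi> t) \<bullet> \<eta> t)"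
proof -
  have "set_integrable lborel {0..M} (\<lambda>t. F (\<psi> \<epsilon> t))" "set_integrable lborel {0..M} (\<lambda>t. F (\<phi> t))"
    "set_integrable lborel {0..M} (\<lambda>t. G (\<phi> t) \<bullet> \<eta> t)"
    by (auto intro!: borel_integrable_atLeastAtMost' continuous_intros
        continuous_on_compose2[OF F_continuous] continuous_on_compose2[OF G_continuous]
        continuous_on_subset[OF \<psi>_continuous]
        continuous_on_subset[OF \<phi>_continuous] continuous_on_subset[OF \<eta>_continuous])
  then show "set_integrable lborel {0<..<M} (\<lambda>t. F (\<psi> \<epsilon> t))" "set_integrable lborel {0<..<M} (\<lambda>t. F (\<phi> t))"
    "set_integrable lborel {0<..<M} (\<lambda>t. G (\<phi> t) \<bullet> \<eta> t)"
    by (auto elim!: set_integrable_subset)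
qed

lemma \<Delta>_integrable: "set_integrable lborel {0<..<M} (\<Delta> \<epsilon>)"
proof -
  have "set_integrable lborel {0<..<M} (\<lambda>t. \<epsilon> * (w t \<bullet> \<eta>' t) + \<epsilon>\<^sup>2 / 2 * (norm (\<eta>' t))\<^sup>2 + (F (\<psi> \<epsilon> t) - F (\<phi> t)))"
    by (intro set_integral_add set_integral_diff set_integrable_mult_right
        inner_integrable \<eta>'_square_integrable F_along_integrable)
  then show ?thesis by (simp add: \<Delta>_def[abs_def])
qed

lemma \<Psi>_action:
  "\<Psi> \<epsilon> \<in> admissible Q \<Phi>0" "action Q (\<Psi> \<epsilon>) = action Q \<Phi> + (LINT t:{0<..<M}|lborel. \<Delta> \<epsilon> t)"
proof -
  let ?L = "\<lambda>t. indicator {0<..} t *\<^sub>R lagrangian Q (\<Psi> \<epsilon>) t"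
  let ?R = "\<lambda>t. indicator {0<..} t *\<^sub>R lagrangian Q \<Phi> t + indicator {0<..<M} t *\<^sub>R \<Delta> \<epsilon> t"
  have L\<Phi>: "integrable lborel (\<lambda>t. indicator {0<..} t *\<^sub>R lagrangian Q \<Phi> t)"
    using \<Phi>_admissible by (simp add: admissible_def set_integrable_def)
  have \<Delta>i: "integrable lborel (\<lambda>t. indicator {0<..<M} t *\<^sub>R \<Delta> \<epsilon> t)"
    using \<Delta>_integrable[of \<epsilon>] unfolding set_integrable_def .
  have Ri: "integrable lborel ?R" using L\<Phi> \<Delta>i by (rule Bochner_Integration.integrable_add)
  have AE: "AE t in lborel. ?L t = ?R t"
    using lagrangian_\<Psi>[of \<epsilon>] by eventually_elim (auto simp: indicator_def)
  \<comment> \<open>Agreement almost everywhere with a Borel function does not imply Borel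
    measurability, so \<open>?L\<close> is treated directly: its kinetic part is measurable by the
    weak velocity, its potential part by continuity.\<close>
  have Lm: "?L \<in> borel_measurable lborel"
  proof -
    have "(\<lambda>t. indicator {0<..} t *\<^sub>R weak_velocity (\<Psi> \<epsilon>) t) \<in> borel_measurable lborel"
      using has_weak_velocity_measurable[OF \<Psi>_velocity(2)] unfolding set_borel_measurable_def .
    moreover have "(\<lambda>t. indicator {0<..} t *\<^sub>R F (\<psi> \<epsilon> t)) \<in> borel_measurable lborel"
    proof -
      have "continuous_on {0<..} (\<lambda>t. F (\<psi> \<epsilon> t))"
        by (intro continuous_on_compose2[OF F_continuous[of UNIV]] continuous_on_subset[OF \<psi>_continuous]) auto
      from borel_measurable_continuous_on_indicator[OF _ this] show ?thesis by simp
    qed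
    ultimately have "(\<lambda>t. 1 / 2 * (norm (indicator {0<..} t *\<^sub>R weak_velocity (\<Psi> \<epsilon>) t))\<^sup>2
        + indicator {0<..} t *\<^sub>R F (\<psi> \<epsilon> t)) \<in> borel_measurable lborel"
      by measurable
    moreover have "(\<lambda>t. 1 / 2 * (norm (indicator {0<..} t *\<^sub>R weak_velocity (\<Psi> \<epsilon>) t))\<^sup>2
        + indicator {0<..} t *\<^sub>R F (\<psi> \<epsilon> t)) = ?L"
      by (auto simp: indicator_def lagrangian_def \<Psi>_def)
    ultimately show ?thesis by simp
  qed
  have Li: "integrable lborel ?L"
    using integrable_cong_AE[OF Lm borel_measurable_integrable[OF Ri] AE] Ri by simp
  have "\<Psi> \<epsilon> 0 = \<Phi>0"
    using \<Phi>_admissible \<Phi>_eq[of 0] by (simp add: admissible_def \<Psi>_def \<psi>_def \<eta>_0)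
  with Li \<Psi>_velocity(2) show "\<Psi> \<epsilon> \<in> admissible Q \<Phi>0"
    unfolding admissible_def H1_loc_def set_integrable_def by blast
  have "integral\<^sup>L lborel ?L = integral\<^sup>L lborel ?R"
    by (rule integral_cong_AE[OF Lm borel_measurable_integrable[OF Ri] AE])
  also have "\<dots> = action Q \<Phi> + (LINT t:{0<..<M}|lborel. \<Delta> \<epsilon> t)"
    unfolding action_def set_lebesgue_integral_def by (rule Bochner_Integration.integral_add[OF L\<Phi> \<Delta>i])
  finally show "action Q (\<Psi> \<epsilon>) = action Q \<Phi> + (LINT t:{0<..<M}|lborel. \<Delta> \<epsilon> t)"
    by (simp add: action_def set_lebesgue_integral_def)
qed

text \<open>\<open>J\<close> is the excess of the action over its minimum, so it is nonnegative and
  zero at 0, and its derivative vanishes there. The kinetic part is an exact quadratic polynomial in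
  \<epsilon>; only the potential term is differentiated under the integral, where the integrand and
  its derivative are continuous on a compact time interval.\<close>

lemma first_variation:
  "(LINT t:{0<..<M}|lborel. w t \<bullet> \<eta>' t) + integral {0..M} (\<lambda>t. G (\<phi> t) \<bullet> \<eta> t) = 0"
proof -
  define a where "a = (LINT t:{0<..<M}|lborel. w t \<bullet> \<eta>' t)"
  define b where "b = (LINT t:{0<..<M}|lborel. (norm (\<eta>' t))\<^sup>2)"
  define I where "I \<epsilon> = integral {0..M} (\<lambda>t. F (\<psi> \<epsilon> t))" for \<epsilon>
  define J where "J \<epsilon> = \<epsilon> * a + \<epsilon>\<^sup>2 / 2 * b + (I \<epsilon> - I 0)" for \<epsilon>
  have \<psi>0: "\<psi> 0 = \<phi>" by (auto simp: \<psi>_def)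
  have LI: "(LINT t:{0<..<M}|lborel. F (\<psi> \<epsilon> t)) = I \<epsilon>" for \<epsilon>
    by (simp add: I_def set_borel_integral_eq_integral(2)[OF F_along_integrable(1)] integral_open_interval_real)
  have "(LINT t:{0<..<M}|lborel. \<Delta> \<epsilon> t) = J \<epsilon>" for \<epsilon>
  proof -
    have i: "set_integrable lborel {0<..<M} (\<lambda>t. \<epsilon> * (w t \<bullet> \<eta>' t))"
      "set_integrable lborel {0<..<M} (\<lambda>t. \<epsilon>\<^sup>2 / 2 * (norm (\<eta>' t))\<^sup>2)"
      by (intro set_integrable_mult_right inner_integrable \<eta>'_square_integrable)+
    show ?thesis
      unfolding \<Delta>_def[abs_def] set_integral_add(2)[OF set_integral_add(1)[OF i] set_integral_diff(1)[OF F_along_integrable(1,2)]]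
        set_integral_add(2)[OF i] set_integral_diff(2)[OF F_along_integrable(1,2)]
      using LI[of \<epsilon>] LI[of 0] by (simp add: J_def a_def b_def \<psi>0)
  qed
  then have "0 \<le> J \<epsilon>" for \<epsilon>
    using \<Phi>_minimizer[OF \<Psi>_action(1)[of \<epsilon>]] \<Psi>_action(2)[of \<epsilon>] by simp
  moreover have "J 0 = 0" by (simp add: J_def)
  moreover have I': "(I has_real_derivative integral {0..M} (\<lambda>t. G (\<phi> t) \<bullet> \<eta> t)) (at 0)"
  proof -
    have "((\<lambda>\<epsilon>. integral (cbox 0 M) (\<lambda>t. F (\<psi> \<epsilon> t))) has_real_derivative
        integral (cbox 0 M) (\<lambda>t. G (\<psi> 0 t) \<bullet> \<eta> t)) (at 0 within UNIV)"
    proof (rule leibniz_rule_field_derivative)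
      fix \<epsilon> t :: real
      have "((\<lambda>\<epsilon>. \<psi> \<epsilon> t) has_derivative (\<lambda>d. d *\<^sub>R \<eta> t)) (at \<epsilon>)"
        unfolding \<psi>_def by (auto intro!: derivative_eq_intros)
      moreover have "(F has_derivative (\<lambda>h. h \<bullet> G (\<psi> \<epsilon> t))) (at (\<psi> \<epsilon> t))"
        using G unfolding gderiv_def .
      ultimately have "((\<lambda>\<epsilon>. F (\<psi> \<epsilon> t)) has_derivative (\<lambda>d. (d *\<^sub>R \<eta> t) \<bullet> G (\<psi> \<epsilon> t))) (at \<epsilon>)"
        by (rule has_derivative_compose)
      moreover have "(\<lambda>d. (d *\<^sub>R \<eta> t) \<bullet> G (\<psi> \<epsilon> t)) = (*) (G (\<psi> \<epsilon> t) \<bullet> \<eta> t)"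
        by (auto simp: inner_commute)
      ultimately show "((\<lambda>\<epsilon>. F (\<psi> \<epsilon> t)) has_real_derivative G (\<psi> \<epsilon> t) \<bullet> \<eta> t) (at \<epsilon> within UNIV)"
        unfolding has_field_derivative_def by simp
    next
      fix \<epsilon> :: real
      show "(\<lambda>t. F (\<psi> \<epsilon> t)) integrable_on cbox 0 M"
        by (intro integrable_continuous continuous_on_compose2[OF F_continuous]
            continuous_on_subset[OF \<psi>_continuous]) auto
    next
      have "continuous_on (UNIV \<times> cbox 0 M) (\<lambda>p::real \<times> real. G (\<phi> (snd p) + fst p *\<^sub>R \<eta> (snd p)) \<bullet> \<eta> (snd p))"
        by (intro continuous_intros continuous_on_compose2[OF G_continuous[of UNIV]]
            continuous_on_compose2[OF \<phi>_continuous] continuous_on_compose2[OF \<eta>_continuous]) auto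
      then show "continuous_on (UNIV \<times> cbox 0 M) (\<lambda>(\<epsilon>, t). G (\<psi> \<epsilon> t) \<bullet> \<eta> t)"
        by (simp add: case_prod_beta' \<psi>_def)
    qed auto
    then show ?thesis by (simp add: I_def[abs_def] \<psi>0)
  qed
  have "(J has_real_derivative a + integral {0..M} (\<lambda>t. G (\<phi> t) \<bullet> \<eta> t)) (at 0)"
    unfolding J_def[abs_def] using I' by (auto intro!: derivative_eq_intros)
  ultimately have "a + integral {0..M} (\<lambda>t. G (\<phi> t) \<bullet> \<eta> t) = 0"
    \<comment> \<open>The minimum is global, so the radius 1 is an arbitrary choice.\<close>
    by (intro DERIV_local_min[of J _ 0 1]) auto
  then show ?thesis by (simp add: a_def)
qed

end

subsection \<open>The Euler-Lagrange equation\<close>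

lemma integral_has_derivative_within:
  fixes f :: "real \<Rightarrow> 'a::banach"
  assumes "continuous_on {0..} f" "0 \<le> t"
  shows "((\<lambda>t. integral {0..t} f) has_vector_derivative f t) (at t within {0..})"
proof -
  have "((\<lambda>t. integral {0..t} f) has_vector_derivative f t) (at t within {0..t + 1})"
    using assms by (intro integral_has_vector_derivative continuous_on_subset[OF assms(1)]) auto
  moreover have "at t within {0..t + 1} = at t within {0..}"
    by (rule at_within_nhd[where S="{..<t + 1}"]) (use assms in auto)
  ultimately show ?thesis by simp
qed

lemma has_integral_indicator_Ioo:
  fixes f :: "real \<Rightarrow> 'a::euclidean_space"
  assumes f: "(f has_integral X) {s..u}" and "a \<le> s" "u \<le> b"
  shows "((\<lambda>t. indicator {s<..<u} t *\<^sub>R f t) has_integral X) {a..b}"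
proof -
  have "((\<lambda>t. if t \<in> {s<..<u} then f t else 0) has_integral X) {a..b}"
    using f assms(2,3) by (subst has_integral_restrict) (auto simp: has_integral_Icc_iff_Ioo)
  then show ?thesis unfolding indicator_scaleR_eq_if .
qed

context torus_minimizer
begin

text \<open>\<open>p\<close> and \<open>P\<close> are the first and second antiderivatives of the
  force along \<open>\<phi>\<close>, vanishing at 0. In these terms the equation of motion says that
  \<open>\<phi> - P\<close> is affine.\<close>

definition p :: "real \<Rightarrow> real ^ 'n" where "p t = integral {0..t} (\<lambda>u. G (\<phi> u))"
definition P :: "real \<Rightarrow> real ^ 'n" where "P t = integral {0..t} p"

lemma G\<phi>_continuous: "continuous_on {0..} (\<lambda>t. G (\<phi> t))"
  by (rule continuous_on_compose2[OF G_continuous[of UNIV] \<phi>_continuous]) auto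

lemma p_derivative: "0 \<le> t \<Longrightarrow> (p has_vector_derivative G (\<phi> t)) (at t within {0..})"
  unfolding p_def[abs_def] by (rule integral_has_derivative_within[OF G\<phi>_continuous])

lemma p_continuous: "continuous_on {0..} p"
  using has_vector_derivative_continuous[OF p_derivative] by (simp add: continuous_on_eq_continuous_within)

lemma P_derivative: "0 \<le> t \<Longrightarrow> (P has_vector_derivative p t) (at t within {0..})"
  unfolding P_def[abs_def] by (rule integral_has_derivative_within[OF p_continuous])

lemma p_has_integral: "0 \<le> s \<Longrightarrow> s \<le> t \<Longrightarrow> (p has_integral (P t - P s)) {s..t}"
  by (rule fundamental_theorem_of_calculus)
    (auto intro: has_vector_derivative_within_subset[OF P_derivative])

text \<open>In the first variation \<open>w\<close> contributes increments of \<open>\<phi>\<close>,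
  and the force, after integration by parts, increments of \<open>P\<close> over the same two
  intervals. The interval (1, 2) does not move with \<open>h\<close>, so the vector multiplied by
  \<open>h\<close> is a constant slope. The ramps may overlap, since every step is linear in
  them.\<close>

lemma corrected_slope:
  assumes h: "0 < h"
  shows "\<phi> h - P h - \<phi> 0 = h *\<^sub>R ((\<phi> 2 - P 2) - (\<phi> 1 - P 1))"
proof -
  have "((\<phi> h - \<phi> 0 - h *\<^sub>R (\<phi> 2 - \<phi> 1)) - (P h - h *\<^sub>R (P 2 - P 1))) \<bullet> e = 0" for e
  proof -
    \<comment> \<open>The second ramp rises to 1 and is weighted by \<open>h\<close>, so it cancels
      the final height \<open>h\<close> of the first one; \<open>q\<close> is the weak derivative of
      \<open>r\<close>.\<close>
    define r where "r t = ramp 0 h t - h * ramp 1 1 t" for t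
    define q where "q t = indicator {0<..<h} t - h * indicator {1<..<2} t" for t :: real
    define M where "M = max h 2"
    have M: "0 < M" "h \<le> M" "2 \<le> M" using h by (auto simp: M_def)
    have r0: "r 0 = 0" "\<And>t. M \<le> t \<Longrightarrow> r t = 0" using h by (auto simp: r_def ramp_def M_def)
    interpret v: torus_variation Q \<Phi>0 \<Phi> \<phi> G "\<lambda>t. r t *\<^sub>R e" "\<lambda>t. q t *\<^sub>R e" M "(1 + h) * norm e"
    proof
      show "continuous_on UNIV (\<lambda>t. r t *\<^sub>R e)"
        unfolding r_def by (intro continuous_intros)
      show "q t *\<^sub>R e = 0" if "M \<le> t" for t using that h by (auto simp: q_def M_def indicator_def)
      show "(\<lambda>t. q t *\<^sub>R e) \<in> borel_measurable lborel" unfolding q_def by measurable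
      show "norm (q t *\<^sub>R e) \<le> (1 + h) * norm e" for t
      proof -
        have "\<bar>q t\<bar> \<le> 1 + h" using h by (auto simp: q_def indicator_def)
        then show ?thesis by (simp add: mult_right_mono)
      qed
      show "has_weak_derivative_on {0<..<T} (\<lambda>t. r t *\<^sub>R e) (\<lambda>t. q t *\<^sub>R e)" if "0 < T" for T
        using has_weak_derivative_on_add_scaleR[OF has_weak_derivative_on_ramp[OF that, of h 0 e]
            has_weak_derivative_on_ramp[OF that, of 1 1 e], of "- h"] h
        by (simp add: r_def q_def scaleR_diff_left)
    qed (use M r0 in auto)
    have "((\<lambda>t. indicator {0<..<h} t *\<^sub>R w t - h *\<^sub>R (indicator {1<..<2} t *\<^sub>R w t)) has_integral
        (\<phi> h - \<phi> 0) - h *\<^sub>R (\<phi> 2 - \<phi> 1)) {0..M}"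
      using h M by (intro has_integral_diff has_integral_cmul has_integral_indicator_Ioo w_has_integral) auto
    then have "((\<lambda>t. q t *\<^sub>R w t) has_integral (\<phi> h - \<phi> 0) - h *\<^sub>R (\<phi> 2 - \<phi> 1)) {0..M}"
      by (simp add: q_def scaleR_diff_left)
    from has_integral_linear[OF this bounded_linear_inner_left[of e], unfolded o_def]
    have "((\<lambda>t. w t \<bullet> (q t *\<^sub>R e)) has_integral ((\<phi> h - \<phi> 0) - h *\<^sub>R (\<phi> 2 - \<phi> 1)) \<bullet> e) {0<..<M}"
      by (simp add: has_integral_Icc_iff_Ioo)
    then have 1: "(LINT t:{0<..<M}|lborel. w t \<bullet> (q t *\<^sub>R e)) = ((\<phi> h - \<phi> 0) - h *\<^sub>R (\<phi> 2 - \<phi> 1)) \<bullet> e"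
      using set_borel_integral_eq_integral(2)[OF v.inner_integrable[of M]] by (simp add: integral_unique)
    have pd: "(p has_vector_derivative G (\<phi> t)) (at t within {0..M})" if "t \<in> {0..M}" for t
      using that by (intro has_vector_derivative_within_subset[OF p_derivative]) auto
    \<comment> \<open>Integration by parts on each ramp trades the force for indicators times
      \<open>p\<close>. The boundary terms cancel: at \<open>M\<close> the ramps have the values
      \<open>h\<close> and 1, and both vanish at 0.\<close>
    have "((\<lambda>t. (ramp 0 h t *\<^sub>R G (\<phi> t) + indicator {0<..<0 + h} t *\<^sub>R p t)
        - h *\<^sub>R (ramp 1 1 t *\<^sub>R G (\<phi> t) + indicator {1<..<1 + 1} t *\<^sub>R p t)) has_integral
        (ramp 0 h M *\<^sub>R p M - ramp 0 h 0 *\<^sub>R p 0) - h *\<^sub>R (ramp 1 1 M *\<^sub>R p M - ramp 1 1 0 *\<^sub>R p 0)) {0..M}"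
      using h M by (intro has_integral_diff has_integral_cmul ramp_by_parts pd) auto
    moreover have "((\<lambda>t. indicator {0<..<h} t *\<^sub>R p t - h *\<^sub>R (indicator {1<..<2} t *\<^sub>R p t)) has_integral
        (P h - P 0) - h *\<^sub>R (P 2 - P 1)) {0..M}"
      using h M by (intro has_integral_diff has_integral_cmul has_integral_indicator_Ioo p_has_integral) auto
    ultimately have "((\<lambda>t. (ramp 0 h t *\<^sub>R G (\<phi> t) + indicator {0<..<0 + h} t *\<^sub>R p t)
        - h *\<^sub>R (ramp 1 1 t *\<^sub>R G (\<phi> t) + indicator {1<..<1 + 1} t *\<^sub>R p t)
        - (indicator {0<..<h} t *\<^sub>R p t - h *\<^sub>R (indicator {1<..<2} t *\<^sub>R p t))) has_integral
        (ramp 0 h M *\<^sub>R p M - ramp 0 h 0 *\<^sub>R p 0) - h *\<^sub>R (ramp 1 1 M *\<^sub>R p M - ramp 1 1 0 *\<^sub>R p 0)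
        - ((P h - P 0) - h *\<^sub>R (P 2 - P 1))) {0..M}"
      by (rule has_integral_diff)
    moreover have "(ramp 0 h M *\<^sub>R p M - ramp 0 h 0 *\<^sub>R p 0) - h *\<^sub>R (ramp 1 1 M *\<^sub>R p M - ramp 1 1 0 *\<^sub>R p 0) = 0"
      using h M by (simp add: ramp_def)
    moreover have "(ramp 0 h t *\<^sub>R G (\<phi> t) + indicator {0<..<0 + h} t *\<^sub>R p t)
        - h *\<^sub>R (ramp 1 1 t *\<^sub>R G (\<phi> t) + indicator {1<..<1 + 1} t *\<^sub>R p t)
        - (indicator {0<..<h} t *\<^sub>R p t - h *\<^sub>R (indicator {1<..<2} t *\<^sub>R p t)) = r t *\<^sub>R G (\<phi> t)" for t
      by (simp add: r_def algebra_simps)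
    ultimately have "((\<lambda>t. r t *\<^sub>R G (\<phi> t)) has_integral
        0 - ((P h - P 0) - h *\<^sub>R (P 2 - P 1))) {0..M}" by (simp only:)
    from has_integral_linear[OF this bounded_linear_inner_left[of e], unfolded o_def]
    have "integral {0..M} (\<lambda>t. G (\<phi> t) \<bullet> (r t *\<^sub>R e)) = (0 - ((P h - P 0) - h *\<^sub>R (P 2 - P 1))) \<bullet> e"
      by (intro integral_unique) simp
    moreover have "P 0 = 0" by (simp add: P_def)
    ultimately show ?thesis
      using v.first_variation 1 by (simp add: inner_simps)
  qed
  \<comment> \<open>The direction \<open>e\<close> is taken to be the vector itself.\<close>
  then have "(\<phi> h - \<phi> 0 - h *\<^sub>R (\<phi> 2 - \<phi> 1)) - (P h - h *\<^sub>R (P 2 - P 1)) = 0"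
    by (rule iffD1[OF inner_eq_zero_iff])
  then show ?thesis by (simp add: algebra_simps)
qed

text \<open>The slope of the affine function \<open>\<phi> - P\<close> plus the derivative of
  \<open>P\<close>: the candidate for the classical velocity.\<close>

definition v :: "real \<Rightarrow> real ^ 'n" where "v t = ((\<phi> 2 - P 2) - (\<phi> 1 - P 1)) + p t"

lemma v_derivative: "0 \<le> t \<Longrightarrow> (v has_vector_derivative G (\<phi> t)) (at t within {0..})"
  unfolding v_def[abs_def] by (auto intro!: derivative_eq_intros p_derivative)

lemma v_continuous: "continuous_on {0..} v"
  unfolding v_def[abs_def] by (intro continuous_intros p_continuous)

text \<open>By \<open>corrected_slope\<close>, \<open>\<phi>\<close> equals an affine function plus
  \<open>P\<close> at every positive time, and at 0 trivially. The right-hand side is differentiable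
  with a known derivative.\<close>

lemma \<phi>_derivative:
  assumes "0 \<le> t"
  shows "(\<phi> has_vector_derivative v t) (at t within {0..})"
proof -
  let ?f = "\<lambda>t. \<phi> 0 + t *\<^sub>R ((\<phi> 2 - P 2) - (\<phi> 1 - P 1)) + P t"
  have eq: "\<phi> t = ?f t" if "0 \<le> t" for t
    using corrected_slope[of t] that by (cases "t = 0") (auto simp: P_def algebra_simps)
  have "(?f has_vector_derivative v t) (at t within {0..})"
    unfolding v_def using assms by (auto intro!: derivative_eq_intros P_derivative)
  then show ?thesis
  proof (rule has_vector_derivative_transform[rotated 2])
    show "t \<in> {0..}" using assms by simp
    show "\<phi> u = ?f u" if "u \<in> {0..}" for u using that by (intro eq) simp
  qed
qed

section \<open>Bootstrapping to smoothness\<close>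

text \<open>\<open>B\<close> contains \<open>f\<close> along \<open>\<phi>\<close> for every real
  analytic \<open>f\<close>, because the chain rule turns one such function into products of
  components of \<open>v\<close> with the partials of \<open>f\<close> along \<open>\<phi>\<close>.
  The equation of motion enters when a component of \<open>v\<close> is differentiated.\<close>

lemma \<phi>_smooth: "smooth_on {0..} \<phi>"
proof -
  define B where "B = range (\<lambda>i t. \<phi> t $ i) \<union> range (\<lambda>i t. v t $ i) \<union> {\<lambda>t. f (\<phi> t) |f. real_analytic f}"
  have comp: "((\<lambda>t. f t $ i) has_vector_derivative d $ i) (at t within {0..})"
    if "(f has_vector_derivative d) (at t within {0..})" for f :: "real \<Rightarrow> real ^ 'n" and d t i
    using bounded_linear.has_vector_derivative[OF bounded_linear_vec_nth that] .
  show ?thesis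
  proof (rule smooth_on_vec_fun_algebra[where B=B])
    show "(\<lambda>t. \<phi> t $ i) \<in> fun_algebra B" for i
      by (rule fun_algebra.base) (auto simp: B_def)
    fix f assume "f \<in> B"
    then consider i where "f = (\<lambda>t. \<phi> t $ i)" | i where "f = (\<lambda>t. v t $ i)"
      | g where "real_analytic g" "f = (\<lambda>t. g (\<phi> t))"
      by (auto simp: B_def)
    then show "\<exists>g\<in>fun_algebra B. \<forall>t\<in>{0..}. (f has_vector_derivative g t) (at t within {0..})"
    proof cases
      case 1
      show ?thesis
        unfolding 1 by (intro bexI[of _ "\<lambda>t. v t $ i"] ballI comp \<phi>_derivative fun_algebra.base)
          (auto simp: B_def)
    next
      case 2
      show ?thesis
        unfolding 2 using G_analytic[of i]
        by (intro bexI[of _ "\<lambda>t. G (\<phi> t) $ i"] ballI comp v_derivative fun_algebra.base)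
          (auto simp: B_def)
    next
      case 3
      from real_analytic_partials[OF 3(1)] obtain H where H: "\<And>x. GDERIV g x :> H x"
        "\<And>i. real_analytic (\<lambda>x. H x $ i)" by blast
      show ?thesis
      proof (intro bexI ballI)
        show "(\<lambda>t. \<Sum>i\<in>UNIV. v t $ i * H (\<phi> t) $ i) \<in> fun_algebra B"
          using H(2) by (intro fun_algebra_sum fun_algebra.mult fun_algebra.base) (auto simp: B_def)
        fix t :: real assume t: "t \<in> {0..}"
        have "(g has_derivative (\<lambda>h. h \<bullet> H (\<phi> t))) (at (\<phi> t))" using H(1) unfolding gderiv_def .
        from has_derivative_compose[OF \<phi>_derivative[unfolded has_vector_derivative_def] this] t
        have "((\<lambda>t. g (\<phi> t)) has_derivative (\<lambda>x. (x *\<^sub>R v t) \<bullet> H (\<phi> t))) (at t within {0..})" by simp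
        then show "(f has_vector_derivative (\<Sum>i\<in>UNIV. v t $ i * H (\<phi> t) $ i)) (at t within {0..})"
          unfolding 3(2) has_vector_derivative_def by (simp add: inner_vec_def sum_distrib_left mult.assoc)
      qed
    qed
  qed
qed

section \<open>Velocity, gradient and energy on the torus\<close>

text \<open>The description operator is justified because lifts differ by constants. The derivative
  within the half-line is unique even at time 0, as \<open>t\<close> lies in the nondegenerate
  interval [0, t + 1].\<close>

lemma velocity_eq:
  assumes t: "0 \<le> t"
  shows "velocity \<Phi> t = v t"
  unfolding velocity_def
proof (rule the_equality)
  show "\<exists>\<phi>. is_lift \<Phi> \<phi> \<and> (\<phi> has_vector_derivative v t) (at t within {0..})"
    using \<phi>_lift \<phi>_derivative[OF t] by blast
  fix u assume "\<exists>\<phi>. is_lift \<Phi> \<phi> \<and> (\<phi> has_vector_derivative u) (at t within {0..})"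
  then obtain \<psi> where \<psi>: "is_lift \<Phi> \<psi>" "(\<psi> has_vector_derivative u) (at t within {0..})" by blast
  obtain c where c: "\<And>t. 0 \<le> t \<Longrightarrow> \<psi> t = \<phi> t + c" using is_lift_unique[OF \<psi>(1) \<phi>_lift] by blast
  have "((\<lambda>t. \<phi> t + c) has_vector_derivative v t) (at t within {0..})"
    by (auto intro!: derivative_eq_intros \<phi>_derivative t)
  then have "(\<psi> has_vector_derivative v t) (at t within {0..})"
    by (intro has_vector_derivative_transform[of t "{0..}" \<psi> "\<lambda>t. \<phi> t + c"]) (use t c in auto)
  then show "u = v t"
    using \<psi>(2) t by (intro vector_derivative_unique_within_closed_interval[of 0 "t + 1" t \<psi>])
      (auto intro: has_vector_derivative_within_subset)
qed

text \<open>Another point \<open>x\<close> over \<open>\<Phi> t\<close> differs from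
  \<open>\<phi> t\<close> by a period \<open>k\<close> of \<open>F\<close>. Translation by
  \<open>k\<close> leaves \<open>F\<close> unchanged and carries the gradient at
  \<open>\<phi> t\<close> to \<open>x\<close>.\<close>

lemma torus_grad_eq:
  assumes t: "0 \<le> t"
  shows "torus_grad Q (\<Phi> t) = G (\<phi> t)"
  unfolding torus_grad_def
proof (rule the_equality)
  show "\<exists>x. torus_proj x = \<Phi> t \<and> GDERIV F x :> G (\<phi> t)"
    using \<Phi>_eq[OF t] G by metis
  fix D assume "\<exists>x. torus_proj x = \<Phi> t \<and> GDERIV F x :> D"
  then obtain x where x: "torus_proj x = \<Phi> t" "GDERIV F x :> D" by blast
  define k where "k = \<phi> t - x"
  have "torus_proj (y + k) = torus_proj y" for y
    using x(1) unfolding \<Phi>_eq[OF t] torus_proj_eq_iff k_def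
    by (metis (no_types, lifting) add_diff_cancel_left' add_uminus_conv_diff minus_diff_eq of_int_minus
        mult_minus_right vector_add_component vector_minus_component)
  then have "F = (\<lambda>y. F (y + k))" by simp
  moreover have "((\<lambda>y. F (y + k)) has_derivative (\<lambda>h. h \<bullet> G (x + k))) (at x)"
  proof -
    have "((\<lambda>y. y + k) has_derivative (\<lambda>h. h)) (at x)" by (auto intro!: derivative_eq_intros)
    from has_derivative_compose[OF this G[unfolded gderiv_def]] show ?thesis .
  qed
  ultimately have "GDERIV F x :> G (x + k)" unfolding gderiv_def by simp
  with x(2) show "D = G (\<phi> t)" by (auto dest: GDERIV_unique simp: k_def)
qed

lemma energy_zero:
  assumes t: "0 \<le> t"
  shows "energy Q \<Phi> t = 0"
proof -
  define E where "E t = 1 / 2 * (v t \<bullet> v t) - F (\<phi> t)" for t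
  have "(E has_vector_derivative 0) (at t within {0..})" if "t \<in> {0..}" for t
  proof -
    have "(F has_derivative (\<lambda>h. h \<bullet> G (\<phi> t))) (at (\<phi> t))" using G unfolding gderiv_def .
    from has_derivative_compose[OF \<phi>_derivative[unfolded has_vector_derivative_def] this] that
    have F': "((\<lambda>t. F (\<phi> t)) has_derivative (\<lambda>x. (x *\<^sub>R v t) \<bullet> G (\<phi> t))) (at t within {0..})" by simp
    have v': "(v has_derivative (\<lambda>x. x *\<^sub>R G (\<phi> t))) (at t within {0..})"
      using v_derivative that by (simp add: has_vector_derivative_def)
    have "(E has_derivative (\<lambda>x. 1 / 2 * (v t \<bullet> (x *\<^sub>R G (\<phi> t)) + (x *\<^sub>R G (\<phi> t)) \<bullet> v t) - (x *\<^sub>R v t) \<bullet> G (\<phi> t)))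
        (at t within {0..})"
      unfolding E_def[abs_def]
      by (intro has_derivative_diff has_derivative_mult_right has_derivative_inner v' F')
    then show ?thesis by (simp add: has_vector_derivative_def inner_commute)
  qed
  from has_vector_derivative_zero_constant[OF convex_real_interval(1) this]
  obtain c where "\<And>t. t \<in> {0..} \<Longrightarrow> E t = c" by blast
  then have c: "E t = c" if "0 \<le> t" for t using that by simp
  \<comment> \<open>The Lagrangian contains the chosen weak velocity, the energy the classical one.
    Both integrate to the increments of \<open>\<phi>\<close>, hence agree almost
    everywhere.\<close>
  have "AE t in lborel. 0 < t \<longrightarrow> w t - v t = 0"
  proof (rule AE_positive_if_AE_bounded)
    fix T :: real assume T: "0 < T"
    show "AE t in lborel. t \<in> {0<..<T} \<longrightarrow> w t - v t = 0"
    proof (rule AE_zero_if_integrals_zero[where d="\<lambda>t. w t - v t"])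
      have "set_integrable lborel {0<..<T} v"
        by (rule set_integrable_subset[OF borel_integrable_atLeastAtMost'[of 0 T]])
          (auto intro: continuous_on_subset[OF v_continuous])
      then show "set_integrable lborel {0<..<T} (\<lambda>t. w t - v t)"
        using w_integrable by (intro set_integral_diff)
      fix s t :: real assume st: "0 < s" "s \<le> t"
      have "(v has_integral (\<phi> t - \<phi> s)) {s..t}"
        by (rule fundamental_theorem_of_calculus)
          (use st in \<open>auto intro: has_vector_derivative_within_subset[OF \<phi>_derivative]\<close>)
      from has_integral_diff[OF w_has_integral this] st
      show "((\<lambda>t. w t - v t) has_integral 0) {s..t}" by simp
    qed
  qed
  \<comment> \<open>\<open>c\<close> is the difference of two nonnegative numbers, kinetic and
    potential, whose sum is the Lagrangian; the sign of \<open>Q\<close> is used here.\<close>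
  then have wv: "AE t in lborel. 0 < t \<longrightarrow> \<bar>c\<bar> \<le> lagrangian Q \<Phi> t"
  proof eventually_elim
    case (elim t)
    show ?case
    proof
      assume t: "0 < t"
      then have "w t = v t" "c = 1 / 2 * (v t \<bullet> v t) - F (\<phi> t)" using elim c[of t] by (auto simp: E_def)
      then show "\<bar>c\<bar> \<le> lagrangian Q \<Phi> t"
        using t Q_nonneg[of "torus_proj (\<phi> t)"] inner_ge_zero[of "v t"]
        by (simp add: lagrangian_def \<Phi>_eq power2_norm_eq_inner abs_le_iff del: inner_ge_zero)
    qed
  qed
  have "integrable lborel (\<lambda>t::real. indicator {0<..} t *\<^sub>R c)"
  proof (rule Bochner_Integration.integrable_bound)
    show "integrable lborel (\<lambda>t. indicator {0<..} t *\<^sub>R lagrangian Q \<Phi> t)"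
      using \<Phi>_admissible by (simp add: admissible_def set_integrable_def)
    show "AE t in lborel. norm (indicator {0<..} t *\<^sub>R c) \<le> norm (indicator {0<..} t *\<^sub>R lagrangian Q \<Phi> t)"
      using wv by eventually_elim (auto simp: indicator_def)
  qed simp
  then have ci: "integrable lborel (\<lambda>t::real. indicator {0<..} t * c)" by simp
  have "c = 0"
  proof (rule ccontr)
    assume "c \<noteq> 0"
    then have "integrable lborel (\<lambda>t::real. indicat_real {0<..} t)"
      using integrable_mult_left[of "1 / c" lborel "\<lambda>t::real. indicat_real {0<..} t * c"] ci by simp
    then have fin: "emeasure lborel {0::real<..} < \<infinity>" by (simp add: integrable_indicator_iff)
    have "ennreal (real n) \<le> emeasure lborel {0::real<..}" for n
    proof -
      have "emeasure lborel {0<..<real n} \<le> emeasure lborel {0::real<..}"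
        by (rule emeasure_mono) auto
      then show ?thesis by simp
    qed
    moreover obtain n :: nat where "emeasure lborel {0::real<..} < of_nat n"
      using fin ennreal_Ex_less_of_nat by auto
    ultimately show False
      by (metis ennreal_of_nat_eq_real_of_nat linorder_not_less)
  qed
  then show ?thesis
    using c[OF t] velocity_eq[OF t] \<Phi>_eq[OF t] by (simp add: energy_def E_def power2_norm_eq_inner)
qed

end

theorem proposition4:
  fixes Q :: "'n::finite torus \<Rightarrow> real"
    and \<Phi>0 :: "'n torus"
    and \<Phi> :: "real \<Rightarrow> 'n torus"
  assumes Q_nonneg: "\<And>p. 0 \<le> Q p"
    and Q_analytic: "torus_analytic Q"
    and \<Phi>_admissible: "\<Phi> \<in> admissible Q \<Phi>0"
    and \<Phi>_minimizer: "\<And>\<Psi>. \<Psi> \<in> admissible Q \<Phi>0 \<Longrightarrow> action Q \<Phi> \<le> action Q \<Psi>"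
  shows "torus_smooth \<Phi>
    \<and> ((\<forall>t>0. (velocity \<Phi> has_vector_derivative torus_grad Q (\<Phi> t)) (at t)) \<and> \<Phi> 0 = \<Phi>0)
    \<and> (\<forall>t\<ge>0. energy Q \<Phi> t = 0)"
proof -
  obtain G where G: "\<And>x. GDERIV (\<lambda>x. Q (torus_proj x)) x :> G x" "\<And>i. real_analytic (\<lambda>x. G x $ i)"
    using real_analytic_partials Q_analytic unfolding torus_analytic_def by blast
  have "\<exists>v. has_weak_velocity \<Phi> v"
    using \<Phi>_admissible by (simp add: admissible_def H1_loc_def)
  then have "has_weak_velocity \<Phi> (weak_velocity \<Phi>)"
    unfolding weak_velocity_def by (rule someI_ex)
  \<comment> \<open>The representative is chosen before the lift, so this lift has exactly the
    velocity of the Lagrangian as its weak derivative.\<close>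
  then obtain \<phi> where \<phi>: "is_lift \<Phi> \<phi>"
    "\<And>T. 0 < T \<Longrightarrow> has_weak_derivative_on {0<..<T} \<phi> (weak_velocity \<Phi>)"
    "\<And>T. 0 < T \<Longrightarrow> square_integrable_on {0<..<T} (weak_velocity \<Phi>)"
    unfolding has_weak_velocity_def by blast
  interpret torus_minimizer Q \<Phi>0 \<Phi> \<phi> G
    by (intro torus_minimizer.intro assms \<phi> G)
  have "(velocity \<Phi> has_vector_derivative torus_grad Q (\<Phi> t)) (at t)" if t: "0 < t" for t
  \<comment> \<open>\<open>velocity \<Phi>\<close> is identified with \<open>v\<close> at
    nonnegative times only, so the two-sided derivative is transferred on the open
    half-line.\<close>
  proof (rule has_vector_derivative_transform_within_open)
    have "at t within {0..} = at t"
      by (rule at_within_interior) (use t in \<open>simp add: interior_real_atLeast\<close>)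
    with v_derivative[of t] t show "(v has_vector_derivative torus_grad Q (\<Phi> t)) (at t)"
      unfolding torus_grad_eq[OF less_imp_le[OF t]] by (simp only: less_imp_le)
    show "t \<in> {0<..}" "open {0::real<..}" using t by simp_all
    show "v u = velocity \<Phi> u" if "u \<in> {0<..}" for u
      using velocity_eq[of u] that by simp
  qed
  moreover have "torus_smooth \<Phi>"
    unfolding torus_smooth_def using \<phi>(1) \<phi>_smooth by blast
  moreover have "\<Phi> 0 = \<Phi>0"
    using \<Phi>_admissible by (simp add: admissible_def)
  ultimately show ?thesis using energy_zero by blast
qed

end
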